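(* Let $s_0\in(0,1)$, let $s_1,\dots,s_n\in[s_0,1)$ and $p_1,\dots,p_n>1$ be such that $\overline{sp}<n$ and $p_{\max}<p^{\ast}$. Then there is a constant $C=C(n,p^{\ast},p^{\ast}-p_{\max},s_0)>0$, depending only on the displayed quantities, such that for every $u\in\mathcal{D}^{\vec{s},\vec{p}}(\mathbb{R}^n)$ $$\|u\|_{L^{p^{\ast}}(\mathbb{R}^n)}\le C\,\|u\|_{\mathcal{D}^{\vec{s},\vec{p}}(\mathbb{R}^n)}.$$
   Context: Given $s_1,\dots,s_n\in(0,1)$ and $p_1,\dots,p_n>1$, define $$\bar{s}=\Big(\frac1n\sum_{i=1}^n\frac1{s_i}\Big)^{-1},\quad \overline{sp}=\Big(\frac1n\sum_{i=1}^n\frac1{s_ip_i}\Big)^{-1},\quad p^{\ast}=\frac{n\,\overline{sp}/\bar{s}}{n-\overline{sp}},\quad p_{\max}=\max\{p_1,\dots,p_n\}.$$ Let $e_i$ be the $i$-th standard unit vector of $\mathbb{R}^n$. For measurable $u:\mathbb{R}^n\to\mathbb{R}$ put $$|D^{s_i}_{p_i}u(x)|^{p_i}=s_i(1-s_i)\int_{\mathbb{R}}\frac{|u(x)-u(x+he_i)|^{p_i}}{|h|^{1+s_ip_i}}\,dh .$$ The homogeneous anisotropic Sobolev space is $$\mathcal{D}^{\vec{s},\vec{p}}(\mathbb{R}^n)=\Big\{u\in L^{p^{\ast}}(\mathbb{R}^n):\ \sum_{i=1}^n\int_{\mathbb{R}^n}|D^{s_i}_{p_i}u(x)|^{p_i}\,dx<\infty\Big\},\qquad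 \|u\|_{\mathcal{D}^{\vec{s},\vec{p}}(\mathbb{R}^n)}=\sum_{i=1}^n\|D^{s_i}_{p_i}u\|_{L^{p_i}(\mathbb{R}^n)},$$ where $\|D^{s_i}_{p_i}u\|_{L^{p_i}(\mathbb{R}^n)}=\big(\int_{\mathbb{R}^n}|D^{s_i}_{p_i}u(x)|^{p_i}\,dx\big)^{1/p_i}$. *)

theory Defs
  imports "HOL-Analysis.Analysis"
begin

(* Exponent vectors are functions on a finite index type 'n, so that n = CARD('n)
   and the underlying space is real^'n, with e_i = axis i 1. *)

definition sbar :: "('n::finite \<Rightarrow> real) \<Rightarrow> real" where
  "sbar s = inverse ((1 / real CARD('n)) * (\<Sum>i\<in>UNIV. 1 / s i))"

definition spbar :: "('n::finite \<Rightarrow> real) \<Rightarrow> ('n \<Rightarrow> real) \<Rightarrow> real" where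
  "spbar s p = inverse ((1 / real CARD('n)) * (\<Sum>i\<in>UNIV. 1 / (s i * p i)))"

definition pstar :: "('n::finite \<Rightarrow> real) \<Rightarrow> ('n \<Rightarrow> real) \<Rightarrow> real" where
  "pstar s p = (real CARD('n) * (spbar s p / sbar s)) / (real CARD('n) - spbar s p)"

definition pmax :: "('n::finite \<Rightarrow> real) \<Rightarrow> real" where
  "pmax p = Max (range p)"

definition Lspace :: "real \<Rightarrow> ('a::euclidean_space \<Rightarrow> real) set" where
  "Lspace q = {u \<in> borel_measurable lebesgue. integrable lebesgue (\<lambda>x. \<bar>u x\<bar> powr q)}"

definition Lnorm :: "real \<Rightarrow> ('a::euclidean_space \<Rightarrow> real) \<Rightarrow> real" where
  "Lnorm q u = (LINT x|lebesgue. \<bar>u x\<bar> powr q) powr (1 / q)"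

(* frac_deriv_pow s p i u x is the p-th power |D^s_p u(x)|^p of the fractional derivative
   in direction e_i; it may be infinite. Its value is unaffected by the convention y / 0 = 0
   at the single point h = 0. *)
definition frac_deriv_pow ::
    "real \<Rightarrow> real \<Rightarrow> 'n::finite \<Rightarrow> (real^'n \<Rightarrow> real) \<Rightarrow> real^'n \<Rightarrow> ennreal" where
  "frac_deriv_pow s p i u x =
     ennreal (s * (1 - s)) *
     (\<integral>\<^sup>+ h. ennreal (\<bar>u x - u (x + h *\<^sub>R axis i 1)\<bar> powr p / \<bar>h\<bar> powr (1 + s * p)) \<partial>lebesgue)"

definition frac_energy ::
    "real \<Rightarrow> real \<Rightarrow> 'n::finite \<Rightarrow> (real^'n \<Rightarrow> real) \<Rightarrow> ennreal" where
  "frac_energy s p i u = (\<integral>\<^sup>+ x. frac_deriv_pow s p i u x \<partial>lebesgue)"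

definition aniso_space ::
    "('n::finite \<Rightarrow> real) \<Rightarrow> ('n \<Rightarrow> real) \<Rightarrow> (real^'n \<Rightarrow> real) set" where
  "aniso_space s p =
     {u \<in> Lspace (pstar s p). (\<Sum>i\<in>UNIV. frac_energy (s i) (p i) i u) < \<infinity>}"

(* enn2real sends infinity to 0, so this is the norm of the paper only on aniso_space s p,
   where every summand has finite energy. *)
definition aniso_norm ::
    "('n::finite \<Rightarrow> real) \<Rightarrow> ('n \<Rightarrow> real) \<Rightarrow> (real^'n \<Rightarrow> real) \<Rightarrow> real" where
  "aniso_norm s p u = (\<Sum>i\<in>UNIV. enn2real (frac_energy (s i) (p i) i u) powr (1 / p i))"

end

(* For a direction i let W(h) be the p-th power of the L^p norm of v - v(. + h e_i).
   Since W(2h) <= 2^p W(h), the factor 1 - s in the energy E_i is exactly what makes the mean of W over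
   (R/2, R] at most C R^{sp} E_i, uniformly as s -> 1.

   If v = L on A and v = 0 off B, average over translations h from a box Q with sides (R_i/2, R_i] and
   |Q| = 2|B|: at least half of the h in Q lead from x in A out of B, so some coordinate step of the path
   from x to x + h changes v by at least L/(2n).  Chebyshev gives |A| <= C sum_i L^{-p_i} R_i^{s_i p_i} E_i.
   The exponent relation sum_i (1/p_i - 1/q)/s_i = 1, q = p*, allows R_i to be powers of |B| for which
   R_i^{s_i p_i} is comparable to |B|^{1 - p_i/q}; if |A| >= 2^{-q-1}|B| this reads
   L^q |A| <= C sum_i E_i^{q/p_i}.

   Applied to the dyadic slices of |u|, whose energies add up to at most that of u (and q > p_i), this
   controls the levels at which |{|u| > 2^{k+1}}| >= 2^{-q-1} |{|u| > 2^k}|; the other levels carry at most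
   half of sum_k 2^{kq} |{|u| > 2^k}|, which is finite since u is in L^q, and are absorbed. *)

theory Submission
  imports Defs
begin

section \<open>Translation differences in one direction\<close>

text \<open>Along \<open>z = h *\<^sub>R axis i 1\<close> this is the W(h) of the overview. Values
  in \<open>ennreal\<close> let Tonelli apply without integrability conditions.\<close>

definition shift_energy :: "real \<Rightarrow> ('a::euclidean_space \<Rightarrow> real) \<Rightarrow> 'a \<Rightarrow> ennreal" where
  "shift_energy p v z = (\<integral>\<^sup>+ x. ennreal (\<bar>v x - v (x + z)\<bar> powr p) \<partial>lborel)"

lemma nn_integral_lborel_shift:
  fixes f :: "'a::euclidean_space \<Rightarrow> ennreal"
  assumes [measurable]: "f \<in> borel_measurable borel"
  shows "(\<integral>\<^sup>+ x. f (x + c) \<partial>lborel) = (\<integral>\<^sup>+ x. f x \<partial>lborel)"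
proof -
  have "(\<integral>\<^sup>+ x. f x \<partial>lborel) = (\<integral>\<^sup>+ x. f x \<partial>(distr lborel borel ((+) c)))"
    by (simp add: lborel_distr_plus)
  also have "\<dots> = (\<integral>\<^sup>+ x. f (x + c) \<partial>lborel)"
    by (subst nn_integral_distr) (auto simp: add.commute)
  finally show ?thesis by simp
qed

lemma powr_add_le:
  fixes a b p :: real
  assumes "0 \<le> a" "0 \<le> b" "1 \<le> p"
  shows "(a + b) powr p \<le> 2 powr (p - 1) * (a powr p + b powr p)"
proof (cases "a = 0 \<or> b = 0")
  case True
  have "1 \<le> 2 powr (p - 1)" using assms by (simp add: ge_one_powr_ge_zero)
  then have "1 * t \<le> 2 powr (p - 1) * t" if "0 \<le> t" for t :: real
    using that by (intro mult_right_mono)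
  with True assms show ?thesis by auto
next
  case False
  \<comment> \<open>Convexity at the midpoint; clearing the denominators gives the factor
    \<open>2 powr (p - 1)\<close>. Zero arguments were split off, so both points are
    positive.\<close>
  have "((1/2) *\<^sub>R a + (1/2) *\<^sub>R b) powr p \<le> (1/2) * (a powr p) + (1/2) * (b powr p)"
    using convex_onD[OF powr_convex[of p], of "1/2" a b] assms False by (simp add: algebra_simps)
  moreover have "((1/2) *\<^sub>R a + (1/2) *\<^sub>R b) = (a + b) / 2" by simp
  ultimately have "((a + b) / 2) powr p \<le> (a powr p + b powr p) / 2"
    by (simp only: add_divide_distrib)
  then have "(a + b) powr p / 2 powr p \<le> (a powr p + b powr p) / 2"
    using assms by (simp add: powr_divide)
  then show ?thesis
    by (simp add: powr_diff field_simps)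
qed

text \<open>A step by \<open>z + z\<close> is two steps by \<open>z\<close>. Convexity costs
  \<open>2 powr (p - 1)\<close>, and by translation invariance the second step has the same integral
  as the first, which supplies the remaining factor 2.\<close>

lemma shift_energy_double:
  fixes v :: "'a::euclidean_space \<Rightarrow> real"
  assumes [measurable]: "v \<in> borel_measurable borel" and p: "1 \<le> p"
  shows "shift_energy p v (z + z) \<le> ennreal (2 powr p) * shift_energy p v z"
proof -
  let ?g = "\<lambda>x. ennreal (\<bar>v x - v (x + z)\<bar> powr p)"
  have "shift_energy p v (z + z) \<le> (\<integral>\<^sup>+ x. ennreal (2 powr (p-1)) * (?g x + ?g (x + z)) \<partial>lborel)"
    unfolding shift_energy_def
  proof (intro nn_integral_mono)
    fix x
    have "\<bar>v x - v (x + (z + z))\<bar> powr p \<le> (\<bar>v x - v (x + z)\<bar> + \<bar>v (x + z) - v (x + z + z)\<bar>) powr p"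
      using p by (intro powr_mono2) (auto simp: add.assoc)
    also have "\<dots> \<le> 2 powr (p - 1) * (\<bar>v x - v (x + z)\<bar> powr p + \<bar>v (x + z) - v (x + z + z)\<bar> powr p)"
      using p by (intro powr_add_le) auto
    finally show "ennreal (\<bar>v x - v (x + (z + z))\<bar> powr p) \<le> ennreal (2 powr (p-1)) * (?g x + ?g (x + z))"
      by (simp add: ennreal_leI flip: ennreal_mult ennreal_plus)
  qed
  also have "\<dots> = ennreal (2 powr (p-1)) * ((\<integral>\<^sup>+ x. ?g x \<partial>lborel) + (\<integral>\<^sup>+ x. ?g (x + z) \<partial>lborel))"
    by (simp add: nn_integral_cmult nn_integral_add)
  also have "(\<integral>\<^sup>+ x. ?g (x + z) \<partial>lborel) = (\<integral>\<^sup>+ x. ?g x \<partial>lborel)"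
    by (rule nn_integral_lborel_shift) measurable
  also have "ennreal (2 powr (p-1)) * (integral\<^sup>N lborel ?g + integral\<^sup>N lborel ?g)
      = ennreal (2 powr (p-1)) * 2 * integral\<^sup>N lborel ?g"
    by (simp add: mult_2 distrib_left mult.assoc)
  also have "ennreal (2 powr (p-1)) * 2 = ennreal (2 powr p)"
    by (subst ennreal_numeral[symmetric], subst ennreal_mult[symmetric]) (auto simp: powr_diff)
  finally show ?thesis by (simp add: shift_energy_def)
qed

lemma measurable_shift_energy [measurable]:
  fixes v :: "'a::euclidean_space \<Rightarrow> real"
  assumes [measurable]: "v \<in> borel_measurable borel"
  shows "shift_energy p v \<in> borel_measurable borel"
proof -
  have "(\<lambda>z. \<integral>\<^sup>+ x. ennreal (\<bar>v x - v (x + z)\<bar> powr p) \<partial>lborel) \<in> borel_measurable borel"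
    by measurable
  then show ?thesis by (simp add: shift_energy_def[abs_def])
qed

text \<open>The gain of the factor \<^term>\<open>1 - s\<close>: the weighted integral over the interval (0, R/2]
  is at least \<^term>\<open>2 powr (- p * (1 - s))\<close> times that over (0, R], so the shell (R/2, R] carries
  only the small remaining fraction.\<close>

lemma shell_integral_le:
  fixes W :: "real \<Rightarrow> ennreal"
  assumes W [measurable]: "W \<in> borel_measurable borel"
    and dbl: "\<And>h. h > 0 \<Longrightarrow> W (2 * h) \<le> ennreal (2 powr p) * W h"
    and s: "0 < s" "s < 1" and p: "0 < p" and R: "0 < R"
  shows "(\<integral>\<^sup>+ h. indicator {R/2<..R} h * W h \<partial>lborel)
     \<le> ennreal (R powr (1 + s * p) * (p * (1 - s))) *
        (\<integral>\<^sup>+ h. W h * ennreal (1 / \<bar>h\<bar> powr (1 + s * p)) \<partial>lborel)"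
proof -
  define g where "g h = W h * ennreal (1 / \<bar>h\<bar> powr (1 + s * p))" for h
  have g [measurable]: "g \<in> borel_measurable borel" by (simp add: g_def[abs_def])
  define I where "I = (\<integral>\<^sup>+ h. indicator {0<..R} h * g h \<partial>lborel)"
  define S where "S = (\<integral>\<^sup>+ h. indicator {R/2<..R} h * g h \<partial>lborel)"
  define J where "J = (\<integral>\<^sup>+ h. indicator {0<..R/2} h * g h \<partial>lborel)"
  \<comment> \<open>Replacing h by h/2 in the integral over (0, R] brings the Jacobian 1/2, the
    weight ratio \<open>2 powr (1 + s * p)\<close> and, by \<open>dbl\<close>, a loss of
    \<open>2 powr (- p)\<close>. Their product is \<open>c\<close>.\<close>
  define c where "c = 2 powr (- (p * (1 - s)))"
  have c: "0 < c" "c < 1" "1 - c \<le> p * (1 - s)"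
  proof -
    have "p * (1 - s) > 0" using p s by simp
    then show "0 < c" "c < 1" by (auto simp: c_def powr_less_one)
    \<comment> \<open>Linearising the exponential turns the lost fraction \<open>1 - c\<close> into
      a multiple of \<open>1 - s\<close>; \<open>ln 2\<close> is then bounded by 1.\<close>
    have "1 + (- (p * (1 - s)) * ln 2) \<le> exp (- (p * (1 - s)) * ln 2)" by (rule exp_ge_add_one_self)
    moreover have "exp (- (p * (1 - s)) * ln 2) = c" by (simp add: c_def powr_def)
    moreover have "(p * (1 - s)) * ln 2 \<le> (p * (1 - s)) * 1"
      using \<open>p * (1 - s) > 0\<close> ln_2_less_1 by (intro mult_left_mono) auto
    ultimately show "1 - c \<le> p * (1 - s)" by (simp only: mult_minus_left mult_1_right)
  qed
  have IJS: "I = J + S"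
    unfolding I_def J_def S_def using R
    by (subst nn_integral_add[symmetric]) (auto intro!: nn_integral_cong split: split_indicator)
  have "J = ennreal (1/2) * (\<integral>\<^sup>+ h. indicator {0<..R/2} (0 + (1/2) * h) * g (0 + (1/2) * h) \<partial>lborel)"
    unfolding J_def by (subst nn_integral_real_affine[where c="1/2" and t=0]) auto
  also have "\<dots> = (\<integral>\<^sup>+ h. ennreal (1/2) * (indicator {0<..R/2} ((1/2) * h) * g ((1/2) * h)) \<partial>lborel)"
    by (subst nn_integral_cmult) auto
  finally have J: "J = (\<integral>\<^sup>+ h. ennreal (1/2) * (indicator {0<..R/2} ((1/2) * h) * g ((1/2) * h)) \<partial>lborel)" .
  have "ennreal c * I = (\<integral>\<^sup>+ h. ennreal c * (indicator {0<..R} h * g h) \<partial>lborel)"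
    unfolding I_def by (subst nn_integral_cmult) auto
  also have "\<dots> \<le> J" unfolding J
  proof (intro nn_integral_mono)
    fix h :: real
    show "ennreal c * (indicator {0<..R} h * g h) \<le> ennreal (1/2) * (indicator {0<..R/2} ((1/2) * h) * g ((1/2) * h))"
    proof (cases "0 < h \<and> h \<le> R")
      case True
      have "ennreal c * g h \<le> ennreal c * ((ennreal (2 powr p) * W (h/2)) * ennreal (1 / \<bar>h\<bar> powr (1 + s * p)))"
        unfolding g_def using dbl[of "h/2"] True by (intro mult_mono) auto
      also have "\<dots> = (ennreal c * ennreal (2 powr p) * ennreal (1 / \<bar>h\<bar> powr (1 + s * p))) * W (h/2)"
        by (simp add: ac_simps)
      also have "ennreal c * ennreal (2 powr p) * ennreal (1 / \<bar>h\<bar> powr (1 + s * p))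
          = ennreal (c * 2 powr p * (1 / \<bar>h\<bar> powr (1 + s * p)))"
        using c by (simp flip: ennreal_mult)
      also have "c * 2 powr p * (1 / \<bar>h\<bar> powr (1 + s * p)) = (1/2) * (1 / \<bar>h/2\<bar> powr (1 + s * p))"
      proof -
        have "c * 2 powr p = 2 powr (s * p)"
          by (simp add: c_def flip: powr_add) (simp add: algebra_simps)
        moreover have "\<bar>h/2\<bar> powr (1 + s * p) = \<bar>h\<bar> powr (1 + s * p) / (2 * 2 powr (s*p))"
          using True by (simp add: powr_divide powr_add)
        ultimately show ?thesis by simp
      qed
      also have "ennreal ((1/2) * (1 / \<bar>h/2\<bar> powr (1 + s * p))) * W (h/2) = ennreal (1/2) * g (h/2)"
        by (subst ennreal_mult) (auto simp: g_def ac_simps)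
      finally show ?thesis using True by simp
    qed auto
  qed
  finally have cI: "ennreal c * I \<le> J" .
  \<comment> \<open>This combines \<open>I = J + S\<close> with
    \<open>ennreal c * I \<le> J\<close>. Subtraction needs \<open>I\<close> finite; for
    \<open>I = top\<close> the right-hand side is \<open>top\<close> because
    \<open>c < 1\<close>.\<close>
  have SI: "S \<le> ennreal (1 - c) * I"
  proof (cases "I = top")
    case True
    then show ?thesis using c by (simp add: ennreal_mult_top)
  next
    case False
    then have "I < top" by (simp add: less_top)
    then obtain i where i: "I = ennreal i" "0 \<le> i" by (cases I) auto
    have "J < top" "S < top" using IJS \<open>I < top\<close> by auto
    then obtain j t where j: "J = ennreal j" "0 \<le> j" "S = ennreal t" "0 \<le> t" by (cases J; cases S) auto
    have "c * i \<le> j" using cI i j c by (simp flip: ennreal_mult)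
    moreover have "i = j + t" using IJS i j by (simp flip: ennreal_plus)
    ultimately have "t \<le> (1 - c) * i" by (simp add: algebra_simps)
    then show ?thesis using i j c by (simp add: ennreal_leI flip: ennreal_mult)
  qed
  \<comment> \<open>On the shell \<open>\<bar>h\<bar>\<close> is at most \<open>R\<close>, so
    putting the singular weight back under the integral costs at most
    \<open>R powr (1 + s * p)\<close>.\<close>
  have "(\<integral>\<^sup>+ h. indicator {R/2<..R} h * W h \<partial>lborel)
      \<le> (\<integral>\<^sup>+ h. ennreal (R powr (1 + s * p)) * (indicator {R/2<..R} h * g h) \<partial>lborel)"
  proof (intro nn_integral_mono)
    fix h :: real
    show "indicator {R/2<..R} h * W h \<le> ennreal (R powr (1 + s * p)) * (indicator {R/2<..R} h * g h)"
    proof (cases "h \<in> {R/2<..R}")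
      case True
      then have h: "0 < h" "h \<le> R" using R by auto
      have "1 \<le> R powr (1 + s * p) * (1 / \<bar>h\<bar> powr (1 + s * p))"
        using h s p by (simp add: field_simps powr_mono2)
      then have "1 * W h \<le> ennreal (R powr (1 + s * p) * (1 / \<bar>h\<bar> powr (1 + s * p))) * W h"
        by (intro mult_right_mono) auto
      then show ?thesis using True by (subst (asm) ennreal_mult) (auto simp: g_def ac_simps)
    qed auto
  qed
  also have "\<dots> = ennreal (R powr (1 + s * p)) * S"
    unfolding S_def by (subst nn_integral_cmult) auto
  also have "\<dots> \<le> ennreal (R powr (1 + s * p)) * (ennreal (p * (1 - s)) * (\<integral>\<^sup>+ h. g h \<partial>lborel))"
  proof (intro mult_left_mono order_trans[OF SI] mult_mono)
    show "I \<le> (\<integral>\<^sup>+ h. g h \<partial>lborel)"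
      unfolding I_def by (intro nn_integral_mono) (auto split: split_indicator)
  qed (use c in \<open>auto intro: ennreal_leI\<close>)
  also have "\<dots> = ennreal (R powr (1 + s * p) * (p * (1 - s))) * (\<integral>\<^sup>+ h. g h \<partial>lborel)"
    using p s by (subst ennreal_mult) (auto simp: mult.assoc)
  finally show ?thesis by (simp add: g_def)
qed

section \<open>Chebyshev bounds and averaging over a box\<close>

text \<open>Chebyshev's inequality. The offset \<open>c\<close> serves the later steps of a path,
  which start away from \<open>x\<close>; translation invariance removes it.\<close>

lemma emeasure_shift_diff_le:
  fixes v :: "'a::euclidean_space \<Rightarrow> real"
  assumes [measurable]: "v \<in> borel_measurable borel" and \<mu>: "0 < \<mu>" and p: "0 < p"
  shows "emeasure lborel {x. \<mu> < \<bar>v (x + c) - v (x + c + z)\<bar>}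
    \<le> ennreal (\<mu> powr (- p)) * shift_energy p v z"
proof -
  let ?f = "\<lambda>x. ennreal (\<bar>v x - v (x + z)\<bar> powr p)"
  have "emeasure lborel {x. \<mu> < \<bar>v (x + c) - v (x + c + z)\<bar>}
      = (\<integral>\<^sup>+ x. indicator {x. \<mu> < \<bar>v (x + c) - v (x + c + z)\<bar>} x \<partial>lborel)"
    by (subst nn_integral_indicator) auto
  also have "\<dots> \<le> (\<integral>\<^sup>+ x. ennreal (\<mu> powr (- p)) * ?f (x + c) \<partial>lborel)"
  proof (intro nn_integral_mono)
    fix x
    let ?d = "\<bar>v (x + c) - v (x + c + z)\<bar>"
    have "1 \<le> \<mu> powr (- p) * ?d powr p" if "\<mu> < ?d"
    proof -
      have "\<mu> powr p \<le> ?d powr p" using that \<mu> p by (intro powr_mono2) auto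
      then show ?thesis using \<mu> by (simp add: powr_minus field_simps)
    qed
    then show "indicator {x. \<mu> < \<bar>v (x + c) - v (x + c + z)\<bar>} x \<le> ennreal (\<mu> powr (- p)) * ?f (x + c)"
      by (auto split: split_indicator simp flip: ennreal_mult)
  qed
  also have "\<dots> = ennreal (\<mu> powr (- p)) * (\<integral>\<^sup>+ x. ?f (x + c) \<partial>lborel)"
    by (subst nn_integral_cmult) auto
  also have "(\<integral>\<^sup>+ x. ?f (x + c) \<partial>lborel) = shift_energy p v z"
    unfolding shift_energy_def by (rule nn_integral_lborel_shift) measurable
  finally show ?thesis .
qed

text \<open>If every single step changes \<open>v\<close> by at most \<open>\<mu>\<close>, the whole
  path changes it by at most \<open>real (card S) * \<mu>\<close>, so a union bound over the steps
  applies. Each step is measured with its own exponent.\<close>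

lemma emeasure_shift_sum_diff_le:
  fixes v :: "'a::euclidean_space \<Rightarrow> real" and z :: "'i \<Rightarrow> 'a"
  assumes [measurable]: "v \<in> borel_measurable borel" and \<mu>: "0 < \<mu>" and p: "\<And>i. 0 < p i"
    and "finite S"
  shows "emeasure lborel {x. real (card S) * \<mu> < \<bar>v x - v (x + (\<Sum>i\<in>S. z i))\<bar>}
    \<le> (\<Sum>i\<in>S. ennreal (\<mu> powr (- p i)) * shift_energy (p i) v (z i))"
  using \<open>finite S\<close>
proof (induction S rule: finite_induct)
  case (insert i S)
  let ?c = "\<Sum>i\<in>S. z i"
  let ?X = "{x. real (card S) * \<mu> < \<bar>v x - v (x + ?c)\<bar>}"
  let ?Y = "{x. \<mu> < \<bar>v (x + ?c) - v (x + ?c + z i)\<bar>}"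
  have "{x. real (card (insert i S)) * \<mu> < \<bar>v x - v (x + (\<Sum>i\<in>insert i S. z i))\<bar>} \<subseteq> ?X \<union> ?Y"
  proof
    fix x assume "x \<in> {x. real (card (insert i S)) * \<mu> < \<bar>v x - v (x + (\<Sum>i\<in>insert i S. z i))\<bar>}"
    then have "real (card S) * \<mu> + \<mu> < \<bar>v x - v (x + ?c + z i)\<bar>"
      using insert by (simp add: algebra_simps)
    then show "x \<in> ?X \<union> ?Y"
      by auto
  qed
  then have "emeasure lborel {x. real (card (insert i S)) * \<mu> < \<bar>v x - v (x + (\<Sum>i\<in>insert i S. z i))\<bar>}
      \<le> emeasure lborel (?X \<union> ?Y)"
    by (intro emeasure_mono) auto
  also have "\<dots> \<le> emeasure lborel ?X + emeasure lborel ?Y"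
    by (intro emeasure_subadditive) auto
  also have "\<dots> \<le> (\<Sum>i\<in>S. ennreal (\<mu> powr (- p i)) * shift_energy (p i) v (z i))
      + ennreal (\<mu> powr (- p i)) * shift_energy (p i) v (z i)"
    by (intro add_mono insert.IH emeasure_shift_diff_le \<mu> p) auto
  finally show ?case using insert by (simp add: add.commute)
qed simp

lemma nn_integral_lborel_vec_prod:
  fixes f :: "'n::finite \<Rightarrow> real \<Rightarrow> ennreal"
  assumes [measurable]: "\<And>i. f i \<in> borel_measurable borel"
  shows "(\<integral>\<^sup>+ x. (\<Prod>i\<in>UNIV. f i ((x :: real^'n) $ i)) \<partial>lborel) = (\<Prod>i\<in>UNIV. \<integral>\<^sup>+ t. f i t \<partial>lborel)"
proof -
  \<comment> \<open>\<open>idx\<close> inverts the bijection from indices to basis vectors, so that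
    the product formula over \<open>Basis\<close> applies to a family indexed by
    \<open>'n\<close>.\<close>
  define idx :: "real^'n \<Rightarrow> 'n" where "idx = the_inv (\<lambda>i. axis i 1)"
  have inj: "inj (\<lambda>i::'n. axis i (1::real))" by (auto simp: inj_on_def axis_eq_axis)
  then have idx: "idx (axis i 1) = i" for i
    unfolding idx_def by (rule the_inv_f_f)
  have bij: "bij_betw (\<lambda>i::'n. axis i (1::real)) UNIV Basis"
    using inj by (auto simp: bij_betw_def Basis_vec_def)
  have "(\<integral>\<^sup>+ x. (\<Prod>i\<in>UNIV. f i ((x :: real^'n) $ i)) \<partial>lborel)
      = (\<integral>\<^sup>+ x. (\<Prod>b\<in>Basis. f (idx b) ((x :: real^'n) \<bullet> b)) \<partial>lborel)"
    by (subst prod.reindex_bij_betw[OF bij, symmetric]) (simp add: idx inner_axis)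
  also have "\<dots> = (\<Prod>b\<in>(Basis :: (real^'n) set). \<integral>\<^sup>+ t. f (idx b) t \<partial>lborel)"
    by (rule nn_integral_lborel_prod) auto
  also have "\<dots> = (\<Prod>i\<in>UNIV. \<integral>\<^sup>+ t. f i t \<partial>lborel)"
    by (subst prod.reindex_bij_betw[OF bij, symmetric]) (simp add: idx)
  finally show ?thesis .
qed

text \<open>The coordinates other than \<open>i\<close> integrate to their side lengths, whose
  product is the volume of the box divided by \<open>R i / 2\<close>. A box average thus becomes a
  shell average in direction \<open>i\<close>.\<close>

lemma nn_integral_box_component:
  fixes R :: "'n::finite \<Rightarrow> real"
  assumes f [measurable]: "f \<in> borel_measurable borel" and R: "\<And>i. 0 < R i"
  shows "(\<integral>\<^sup>+ h. indicator {h. \<forall>j. h $ j \<in> {R j / 2<..R j}} (h :: real^'n) * f (h $ i) \<partial>lborel)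
    = ennreal ((\<Prod>j\<in>UNIV. R j / 2) * (2 / R i)) * (\<integral>\<^sup>+ t. indicator {R i / 2<..R i} t * f t \<partial>lborel)"
proof -
  \<comment> \<open>The function is attached to the \<open>i\<close>-th factor alone, which makes
    the integrand a product over the coordinates.\<close>
  define F where "F j t = indicator {R j / 2<..R j} t * (if j = i then f t else 1)" for j t
  have "(\<integral>\<^sup>+ h. indicator {h. \<forall>j. h $ j \<in> {R j / 2<..R j}} (h :: real^'n) * f (h $ i) \<partial>lborel)
      = (\<integral>\<^sup>+ h. (\<Prod>j\<in>UNIV. F j ((h :: real^'n) $ j)) \<partial>lborel)"
  proof (intro nn_integral_cong)
    fix h :: "real^'n"
    have "(\<Prod>j\<in>UNIV. F j (h $ j)) = (\<Prod>j\<in>UNIV. indicator {R j / 2<..R j} (h $ j)) * f (h $ i)"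
      by (simp add: F_def prod.distrib prod.delta)
    moreover have "(\<Prod>j\<in>UNIV. indicator {R j / 2<..R j} (h $ j))
        = (indicator {h. \<forall>j. h $ j \<in> {R j / 2<..R j}} h :: ennreal)"
      by (auto simp: indicator_def intro: prod.neutral)
    ultimately show "indicator {h. \<forall>j. h $ j \<in> {R j / 2<..R j}} h * f (h $ i) = (\<Prod>j\<in>UNIV. F j (h $ j))"
      by simp
  qed
  also have "\<dots> = (\<Prod>j\<in>UNIV. \<integral>\<^sup>+ t. F j t \<partial>lborel)"
    by (rule nn_integral_lborel_vec_prod) (simp add: F_def[abs_def])
  also have "\<dots> = (\<integral>\<^sup>+ t. F i t \<partial>lborel) * (\<Prod>j\<in>UNIV - {i}. \<integral>\<^sup>+ t. F j t \<partial>lborel)"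
    by (rule prod.remove) auto
  also have "(\<Prod>j\<in>UNIV - {i}. \<integral>\<^sup>+ t. F j t \<partial>lborel) = (\<Prod>j\<in>UNIV - {i}. ennreal (R j / 2))"
  proof (intro prod.cong refl)
    fix j assume "j \<in> UNIV - {i}"
    moreover have "R j / 2 \<le> R j" using R[of j] by simp
    ultimately show "(\<integral>\<^sup>+ t. F j t \<partial>lborel) = ennreal (R j / 2)"
      by (simp add: F_def field_simps)
  qed
  also have "\<dots> = ennreal (\<Prod>j\<in>UNIV - {i}. R j / 2)"
    using R by (intro prod_ennreal) (auto intro: less_imp_le)
  also have "(\<Prod>j\<in>UNIV - {i}. R j / 2) = (\<Prod>j\<in>UNIV. R j / 2) * (2 / R i)"
    using R[of i] by (subst prod.remove[of UNIV i]) auto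
  finally show ?thesis by (simp add: F_def mult.commute)
qed

text \<open>The pairs of \<open>x \<in> A\<close> and \<open>h\<close> in the box with
  \<open>x + h \<notin> B\<close> are measured twice: their measure is at least \<open>b\<close>
  times that of \<open>A\<close>, while for each fixed \<open>h\<close> the path bound estimates the
  section.\<close>

lemma emeasure_level_le:
  fixes v :: "real^'n::finite \<Rightarrow> real" and R p :: "'n \<Rightarrow> real"
  assumes v [measurable]: "v \<in> borel_measurable borel"
    and A [measurable]: "A \<in> sets borel" and B [measurable]: "B \<in> sets borel"
    and vA: "\<And>x. x \<in> A \<Longrightarrow> v x = L" and vB: "\<And>x. x \<notin> B \<Longrightarrow> v x = 0"
    and L: "0 < L" and p: "\<And>i. 0 < p i" and R: "\<And>i. 0 < R i"
    and b: "emeasure lborel B = ennreal b" "0 < b" and Rb: "(\<Prod>i\<in>UNIV. R i / 2) = 2 * b"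
  shows "emeasure lborel A \<le>
    (\<Sum>i\<in>UNIV. ennreal (4 * (L / (2 * real CARD('n))) powr (- p i) / R i) *
       (\<integral>\<^sup>+ t. indicator {R i / 2<..R i} t * shift_energy (p i) v (t *\<^sub>R axis i 1) \<partial>lborel))"
proof -
  \<comment> \<open>Going from \<open>A\<close> to the complement of \<open>B\<close> changes
    \<open>v\<close> by \<open>L\<close>. Since \<open>real CARD('n) * \<mu>\<close> is only
    \<open>L / 2\<close>, the strict inequality of the path bound holds.\<close>
  define \<mu> where "\<mu> = L / (2 * real CARD('n))"
  have \<mu>: "0 < \<mu>" using L by (simp add: \<mu>_def)
  define Q where "Q = {h::real^'n. \<forall>j. h $ j \<in> {R j / 2<..R j}}"
  have Q [measurable]: "Q \<in> sets borel"
    unfolding Q_def by measurable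
  have eQ: "emeasure lborel Q = ennreal (2 * b)"
  proof -
    \<comment> \<open>The volume is the box integral of the constant 1, which can be read off in any
      one direction.\<close>
    obtain i :: 'n where True by simp
    have "emeasure lborel Q = (\<integral>\<^sup>+ h. indicator Q h * (1::ennreal) \<partial>lborel)"
      by simp
    also have "\<dots> = ennreal ((\<Prod>j\<in>UNIV. R j / 2) * (2 / R i)) * (\<integral>\<^sup>+ t. indicator {R i / 2<..R i} t * (1::ennreal) \<partial>lborel)"
      unfolding Q_def by (rule nn_integral_box_component[where f="\<lambda>_. 1"]) (auto intro: R)
    also have "(\<integral>\<^sup>+ t. indicator {R i / 2<..R i} t * (1::ennreal) \<partial>lborel) = ennreal (R i / 2)"
      using R[of i] by (simp add: field_simps)
    finally show ?thesis
      using R[of i] b by (simp add: Rb flip: ennreal_mult)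
  qed
  let ?W = "\<lambda>i t. shift_energy (p i) v (t *\<^sub>R axis i 1)"
  have *: "emeasure lborel {x \<in> A. x + h \<notin> B} \<le> (\<Sum>i\<in>UNIV. ennreal (\<mu> powr (- p i)) * ?W i (h $ i))" for h
  proof -
    have h: "h = (\<Sum>i\<in>UNIV. (h $ i) *\<^sub>R axis i 1)"
      using basis_expansion[of h] by (simp add: scalar_mult_eq_scaleR)
    have "{x \<in> A. x + h \<notin> B} \<subseteq> {x. real CARD('n) * \<mu> < \<bar>v x - v (x + h)\<bar>}"
      using vA vB L by (auto simp: \<mu>_def)
    then have "emeasure lborel {x \<in> A. x + h \<notin> B} \<le> emeasure lborel {x. real CARD('n) * \<mu> < \<bar>v x - v (x + h)\<bar>}"
      by (intro emeasure_mono) auto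
    also have "\<dots> \<le> (\<Sum>i\<in>UNIV. ennreal (\<mu> powr (- p i)) * ?W i (h $ i))"
      using emeasure_shift_sum_diff_le[OF v \<mu> p, of UNIV "\<lambda>i. (h $ i) *\<^sub>R axis i 1"]
      by (simp flip: h)
    finally show ?thesis .
  qed
  \<comment> \<open>Whatever \<open>x\<close> is, the \<open>h\<close> with
    \<open>x + h \<in> B\<close> form a translate of \<open>B\<close>, of measure \<open>b\<close>,
    whereas the box has measure \<open>2 * b\<close>.\<close>
  have low: "ennreal b \<le> (\<integral>\<^sup>+ h. indicator Q h * indicator (- B) (x + h) \<partial>lborel)" for x
  proof -
    have "emeasure lborel {h. x + h \<in> B} = (\<integral>\<^sup>+ h. indicator {h. x + h \<in> B} h \<partial>lborel)"
      by (rule nn_integral_indicator[symmetric]) measurable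
    also have "\<dots> = (\<integral>\<^sup>+ h. indicator B (h + x) \<partial>lborel)"
      by (intro nn_integral_cong) (auto simp: add.commute split: split_indicator)
    also have "\<dots> = (\<integral>\<^sup>+ h. indicator B h \<partial>lborel)"
      by (rule nn_integral_lborel_shift) measurable
    finally have "emeasure lborel {h. x + h \<in> B} = ennreal b" using b by simp
    moreover have "emeasure lborel Q \<le> emeasure lborel ({h \<in> Q. x + h \<notin> B} \<union> {h. x + h \<in> B})"
      by (intro emeasure_mono) auto
    moreover have "\<dots> \<le> emeasure lborel {h \<in> Q. x + h \<notin> B} + emeasure lborel {h. x + h \<in> B}"
      by (intro emeasure_subadditive) auto
    ultimately have "ennreal (2 * b) \<le> emeasure lborel {h \<in> Q. x + h \<notin> B} + ennreal b"
      using eQ by auto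
    then have "ennreal b \<le> emeasure lborel {h \<in> Q. x + h \<notin> B}"
      using b(2) by (cases "emeasure lborel {h \<in> Q. x + h \<notin> B}")
        (auto simp flip: ennreal_plus)
    also have "\<dots> = (\<integral>\<^sup>+ h. indicator {h \<in> Q. x + h \<notin> B} h \<partial>lborel)"
      by (rule nn_integral_indicator[symmetric]) measurable
    also have "\<dots> = (\<integral>\<^sup>+ h. indicator Q h * indicator (- B) (x + h) \<partial>lborel)"
      by (intro nn_integral_cong) (auto split: split_indicator)
    finally show ?thesis .
  qed
  \<comment> \<open>Double counting of the pairs; Tonelli exchanges the order, and the common factor
    \<open>b\<close> is cancelled at the end.\<close>
  have "ennreal b * emeasure lborel A = (\<integral>\<^sup>+ x. indicator A x * ennreal b \<partial>lborel)"
    by (subst nn_integral_multc) (auto simp: mult.commute)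
  also have "\<dots> \<le> (\<integral>\<^sup>+ x. indicator A x * (\<integral>\<^sup>+ h. indicator Q h * indicator (- B) (x + h) \<partial>lborel) \<partial>lborel)"
    by (intro nn_integral_mono mult_left_mono low) auto
  also have "\<dots> = (\<integral>\<^sup>+ x. (\<integral>\<^sup>+ h. indicator A x * (indicator Q h * indicator (- B) (x + h)) \<partial>lborel) \<partial>lborel)"
    by (intro nn_integral_cong, subst nn_integral_cmult[symmetric]) auto
  also have "\<dots> = (\<integral>\<^sup>+ h. (\<integral>\<^sup>+ x. indicator A x * (indicator Q h * indicator (- B) (x + h)) \<partial>lborel) \<partial>lborel)"
    by (rule lborel_pair.Fubini') measurable
  also have "\<dots> = (\<integral>\<^sup>+ h. indicator Q h * emeasure lborel {x \<in> A. x + h \<notin> B} \<partial>lborel)"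
  proof (intro nn_integral_cong)
    fix h
    have "(\<integral>\<^sup>+ x. indicator A x * (indicator Q h * indicator (- B) (x + h)) \<partial>lborel)
        = (\<integral>\<^sup>+ x. indicator Q h * indicator {x \<in> A. x + h \<notin> B} x \<partial>lborel)"
      by (intro nn_integral_cong) (auto split: split_indicator)
    also have "\<dots> = indicator Q h * (\<integral>\<^sup>+ x. indicator {x \<in> A. x + h \<notin> B} x \<partial>lborel)"
      by (rule nn_integral_cmult) measurable
    also have "(\<integral>\<^sup>+ x. indicator {x \<in> A. x + h \<notin> B} x \<partial>lborel) = emeasure lborel {x \<in> A. x + h \<notin> B}"
      by (rule nn_integral_indicator) measurable
    finally show "(\<integral>\<^sup>+ x. indicator A x * (indicator Q h * indicator (- B) (x + h)) \<partial>lborel)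
        = indicator Q h * emeasure lborel {x \<in> A. x + h \<notin> B}" .
  qed
  also have "\<dots> \<le> (\<integral>\<^sup>+ h. indicator Q h * (\<Sum>i\<in>UNIV. ennreal (\<mu> powr (- p i)) * ?W i (h $ i)) \<partial>lborel)"
    by (intro nn_integral_mono mult_left_mono *) auto
  also have "\<dots> = (\<Sum>i\<in>UNIV. (\<integral>\<^sup>+ h. ennreal (\<mu> powr (- p i)) * (indicator Q h * ?W i (h $ i)) \<partial>lborel))"
    by (subst nn_integral_sum[symmetric]) (auto simp: sum_distrib_left ac_simps)
  also have "\<dots> = (\<Sum>i\<in>UNIV. ennreal (\<mu> powr (- p i)) * (ennreal (2 * b * (2 / R i)) *
       (\<integral>\<^sup>+ t. indicator {R i / 2<..R i} t * ?W i t \<partial>lborel)))"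
    unfolding Rb[symmetric]
    by (intro sum.cong refl, subst nn_integral_cmult, measurable,
        subst nn_integral_box_component[symmetric]) (auto simp: Q_def intro: R)
  also have "\<dots> = ennreal b * (\<Sum>i\<in>UNIV. ennreal (4 * \<mu> powr (- p i) / R i) * (\<integral>\<^sup>+ t. indicator {R i / 2<..R i} t * ?W i t \<partial>lborel))"
  proof (subst sum_distrib_left, intro sum.cong refl)
    fix i
    \<comment> \<open>The volume \<open>2 * b\<close> divided by the side \<open>R i / 2\<close>,
      with one factor \<open>b\<close> taken out, leaves \<open>4 / R i\<close>.\<close>
    have "ennreal (\<mu> powr (- p i)) * ennreal (2 * b * (2 / R i)) = ennreal b * ennreal (4 * \<mu> powr (- p i) / R i)"
      using b R[of i] by (simp flip: ennreal_mult)
    then show "ennreal (\<mu> powr (- p i)) * (ennreal (2 * b * (2 / R i)) * (\<integral>\<^sup>+ t. indicator {R i / 2<..R i} t * ?W i t \<partial>lborel))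
       = ennreal b * (ennreal (4 * \<mu> powr (- p i) / R i) * (\<integral>\<^sup>+ t. indicator {R i / 2<..R i} t * ?W i t \<partial>lborel))"
      by (simp add: mult.assoc[symmetric])
  qed
  finally show ?thesis
    using b(2) by (subst (asm) ennreal_mult_le_mult_iff) (auto simp: \<mu>_def)
qed

section \<open>Level sets bounded by the fractional energy\<close>

text \<open>Tonelli takes the integral over \<open>x\<close> inside; Borel measurability of
  \<open>v\<close> makes the integrand jointly measurable.\<close>

lemma frac_energy_borel:
  fixes v :: "real^'n::finite \<Rightarrow> real"
  assumes [measurable]: "v \<in> borel_measurable borel"
  shows "frac_energy s p i v = ennreal (s * (1 - s)) *
    (\<integral>\<^sup>+ h. shift_energy p v (h *\<^sub>R axis i 1) * ennreal (1 / \<bar>h\<bar> powr (1 + s * p)) \<partial>lborel)"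
proof -
  have "frac_energy s p i v = (\<integral>\<^sup>+ x. ennreal (s * (1 - s)) *
     (\<integral>\<^sup>+ h. ennreal (\<bar>v x - v (x + h *\<^sub>R axis i 1)\<bar> powr p / \<bar>h\<bar> powr (1 + s * p)) \<partial>lborel) \<partial>lborel)"
    by (simp add: frac_energy_def frac_deriv_pow_def nn_integral_completion)
  also have "\<dots> = ennreal (s * (1 - s)) * (\<integral>\<^sup>+ x.
     (\<integral>\<^sup>+ h. ennreal (\<bar>v x - v (x + h *\<^sub>R axis i 1)\<bar> powr p / \<bar>h\<bar> powr (1 + s * p)) \<partial>lborel) \<partial>lborel)"
    by (rule nn_integral_cmult) measurable
  also have "(\<integral>\<^sup>+ x. (\<integral>\<^sup>+ h. ennreal (\<bar>v x - v (x + h *\<^sub>R axis i 1)\<bar> powr p / \<bar>h\<bar> powr (1 + s * p)) \<partial>lborel) \<partial>lborel)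
    = (\<integral>\<^sup>+ h. (\<integral>\<^sup>+ x. ennreal (\<bar>v x - v (x + h *\<^sub>R axis i 1)\<bar> powr p / \<bar>h\<bar> powr (1 + s * p)) \<partial>lborel) \<partial>lborel)"
    by (rule lborel_pair.Fubini') measurable
  also have "\<dots> = (\<integral>\<^sup>+ h. shift_energy p v (h *\<^sub>R axis i 1) * ennreal (1 / \<bar>h\<bar> powr (1 + s * p)) \<partial>lborel)"
    unfolding shift_energy_def
    by (intro nn_integral_cong, subst nn_integral_multc[symmetric])
       (auto simp flip: ennreal_mult)
  finally show ?thesis .
qed

lemma emeasure_level_le_energy:
  fixes v :: "real^'n::finite \<Rightarrow> real" and R p s :: "'n \<Rightarrow> real"
  assumes v [measurable]: "v \<in> borel_measurable borel"
    and A: "A \<in> sets borel" and B: "B \<in> sets borel"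
    and vA: "\<And>x. x \<in> A \<Longrightarrow> v x = L" and vB: "\<And>x. x \<notin> B \<Longrightarrow> v x = 0"
    and L: "0 < L" and p: "\<And>i. 1 < p i" and s: "\<And>i. 0 < s i" "\<And>i. s i < 1" and R: "\<And>i. 0 < R i"
    and b: "emeasure lborel B = ennreal b" "0 < b" and Rb: "(\<Prod>i\<in>UNIV. R i / 2) = 2 * b"
  shows "emeasure lborel A \<le>
    (\<Sum>i\<in>UNIV. ennreal (4 * (L / (2 * real CARD('n))) powr (- p i) * R i powr (s i * p i) * (p i / s i))
      * frac_energy (s i) (p i) i v)"
proof -
  have p0: "0 < p i" for i using p[of i] by simp
  note emeasure_level_le[OF v A B vA vB L p0 R b Rb]
  also have "(\<Sum>i\<in>UNIV. ennreal (4 * (L / (2 * real CARD('n))) powr (- p i) / R i) *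
       (\<integral>\<^sup>+ t. indicator {R i / 2<..R i} t * shift_energy (p i) v (t *\<^sub>R axis i 1) \<partial>lborel))
    \<le> (\<Sum>i\<in>UNIV. ennreal (4 * (L / (2 * real CARD('n))) powr (- p i) * R i powr (s i * p i) * (p i / s i))
      * frac_energy (s i) (p i) i v)"
  proof (intro sum_mono)
    fix i
    let ?m = "(L / (2 * real CARD('n))) powr (- p i)"
    let ?W = "\<lambda>t::real. shift_energy (p i) v (t *\<^sub>R axis i 1)"
    let ?I = "\<integral>\<^sup>+ h. ?W h * ennreal (1 / \<bar>h\<bar> powr (1 + s i * p i)) \<partial>lborel"
    have "(\<integral>\<^sup>+ t. indicator {R i / 2<..R i} t * ?W t \<partial>lborel)
       \<le> ennreal (R i powr (1 + s i * p i) * (p i * (1 - s i))) * ?I"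
    proof (rule shell_integral_le)
      fix h :: real
      show "?W (2 * h) \<le> ennreal (2 powr p i) * ?W h"
        using shift_energy_double[OF v, of "p i" "h *\<^sub>R axis i 1"] p[of i]
        by (simp flip: scaleR_2)
    qed (use p0 s R in auto)
    then have "ennreal (4 * ?m / R i) * (\<integral>\<^sup>+ t. indicator {R i / 2<..R i} t * ?W t \<partial>lborel)
      \<le> ennreal (4 * ?m / R i) * (ennreal (R i powr (1 + s i * p i) * (p i * (1 - s i))) * ?I)"
      by (intro mult_left_mono) auto
    also have "\<dots> = ennreal (4 * ?m / R i * (R i powr (1 + s i * p i) * (p i * (1 - s i)))) * ?I"
      using p0[of i] s[of i] R[of i] by (subst ennreal_mult) (auto simp: mult.assoc)
    \<comment> \<open>The factor \<open>1 - s i\<close> from the shell estimate joins the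
      normalisation \<open>s i * (1 - s i)\<close> of the energy. Only \<open>p i / s i\<close> is
      left, and nothing degenerates as \<open>s i\<close> tends to 1.\<close>
    also have "4 * ?m / R i * (R i powr (1 + s i * p i) * (p i * (1 - s i)))
       = (4 * ?m * R i powr (s i * p i) * (p i / s i)) * (s i * (1 - s i))"
      using s[of i] R[of i] by (simp add: powr_add field_simps)
    also have "ennreal \<dots> * ?I = ennreal (4 * ?m * R i powr (s i * p i) * (p i / s i)) * frac_energy (s i) (p i) i v"
      using p0[of i] s[of i] R[of i]
      by (subst ennreal_mult) (auto simp: mult.assoc frac_energy_borel)
    finally show "ennreal (4 * ?m / R i) * (\<integral>\<^sup>+ t. indicator {R i / 2<..R i} t * ?W t \<partial>lborel)
      \<le> ennreal (4 * ?m * R i powr (s i * p i) * (p i / s i)) * frac_energy (s i) (p i) i v" .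
  qed
  finally show ?thesis .
qed

section \<open>Pairs of level sets of comparable measure\<close>

text \<open>Some summand is at least the average; it is solved for
  \<open>L powr p i * a powr (p i / q)\<close> and raised to the power \<open>q / p i\<close>. One
  factor \<open>\<epsilon> i\<close> is kept and the remaining power is bounded through
  \<open>e i\<close>: a bound linear in \<open>\<epsilon> i\<close> can be summed over
  slices.\<close>

lemma power_level_le:
  fixes p e :: "'n::finite \<Rightarrow> real"
  assumes a: "0 < a" and L: "0 < L" and p: "\<And>i. 1 < p i" "\<And>i. p i < q" and K: "1 \<le> K"
    and \<epsilon>: "\<And>i. 0 \<le> \<epsilon> i" "\<And>i. \<epsilon> i \<le> e i"
    and le: "a \<le> (\<Sum>i\<in>UNIV. K * L powr (- p i) * a powr (1 - p i / q) * \<epsilon> i)"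
  shows "L powr q * a \<le> (\<Sum>i\<in>UNIV. (real CARD('n) * K) powr q * e i powr (q / p i - 1) * \<epsilon> i)"
proof -
  let ?n = "real CARD('n)"
  have n: "1 \<le> ?n" by (simp add: Suc_leI)
  define D where "D = ?n * K"
  have D: "1 \<le> D" using mult_mono[OF n K] by (simp add: D_def)
  obtain i where i: "a \<le> D * L powr (- p i) * a powr (1 - p i / q) * \<epsilon> i"
  proof -
    have "\<exists>i. a / ?n \<le> K * L powr (- p i) * a powr (1 - p i / q) * \<epsilon> i"
    proof (rule ccontr)
      assume "\<nexists>i. a / ?n \<le> K * L powr (- p i) * a powr (1 - p i / q) * \<epsilon> i"
      then have "(\<Sum>i\<in>UNIV. K * L powr (- p i) * a powr (1 - p i / q) * \<epsilon> i) < (\<Sum>i\<in>(UNIV::'n set). a / ?n)"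
        by (intro sum_strict_mono) (auto simp: not_le)
      then show False using le by simp
    qed
    then show ?thesis using that n by (auto simp: D_def field_simps)
  qed
  have pq: "0 < p i" "p i < q" "0 < q" "1 < q / p i" using p[of i] by auto
  have "L powr p i * a powr (p i / q) \<le> D * \<epsilon> i"
  proof -
    have "a = a powr (p i / q) * a powr (1 - p i / q)"
      using a by (simp flip: powr_add)
    then have "a powr (p i / q) * a powr (1 - p i / q) \<le> (D * L powr (- p i) * \<epsilon> i) * a powr (1 - p i / q)"
      using i by (simp add: ac_simps)
    then have "a powr (p i / q) \<le> D * L powr (- p i) * \<epsilon> i"
      using a by simp
    then show ?thesis using L by (simp add: powr_minus field_simps)
  qed
  then have "(L powr p i * a powr (p i / q)) powr (q / p i) \<le> (D * \<epsilon> i) powr (q / p i)"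
    using pq by (intro powr_mono2) auto
  also have "(L powr p i * a powr (p i / q)) powr (q / p i) = L powr q * a"
    using L a pq by (simp add: powr_mult powr_powr)
  also have "(D * \<epsilon> i) powr (q / p i) = D powr (q / p i) * (\<epsilon> i powr (q / p i - 1) * \<epsilon> i)"
  proof -
    have "\<epsilon> i powr (q / p i - 1) * \<epsilon> i = \<epsilon> i powr (q / p i)"
    proof (cases "\<epsilon> i = 0")
      case False
      then show ?thesis using \<epsilon>(1)[of i] by (simp add: powr_diff)
    qed simp
    then show ?thesis using D \<epsilon>(1)[of i] by (simp add: powr_mult)
  qed
  \<comment> \<open>Since \<open>1 \<le> D\<close> and \<open>q / p i \<le> q\<close>, the constant
    becomes independent of \<open>p i\<close>.\<close>
  also have "\<dots> \<le> D powr q * (e i powr (q / p i - 1) * \<epsilon> i)"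
  proof (intro mult_mono powr_mono powr_mono2)
    have "1 * q \<le> p i * q" using p[of i] by (intro mult_right_mono) auto
    then show "q / p i \<le> q" using pq by (simp add: field_simps)
  qed (use D \<epsilon>[of i] pq in auto)
  also have "\<dots> = D powr q * e i powr (q / p i - 1) * \<epsilon> i" by simp
  also have "\<dots> \<le> (\<Sum>i\<in>UNIV. D powr q * e i powr (q / p i - 1) * \<epsilon> i)"
    using \<epsilon>(1) by (intro member_le_sum) auto
  finally show ?thesis by (simp add: D_def)
qed

text \<open>One factor for each loss in \<open>strong_level_le\<close>: 4 from the box average,
  \<open>(2 * real n) powr q\<close> from the step size, \<open>q / s0\<close> from
  \<open>p i / s i\<close>, and the last from replacing the scale of the box by the measure of the
  smaller set.\<close>

definition level_const :: "nat \<Rightarrow> real \<Rightarrow> real \<Rightarrow> real" where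
  "level_const n q s0 = 4 * (2 * real n) powr q * (q / s0) * 2 powr (real n + q + 2)"

lemma one_le_level_const:
  assumes "1 \<le> n" "1 < q" "0 < s0" "s0 < 1"
  shows "1 \<le> level_const n q s0"
proof -
  have "1 * 1 * 1 * 1 \<le> 4 * (2 * real n) powr q * (q / s0) * 2 powr (real n + q + 2)"
    using assms by (intro mult_mono ge_one_powr_ge_zero) (auto simp: field_simps)
  then show ?thesis by (simp add: level_const_def)
qed

text \<open>The side lengths are powers of a single scale \<open>M\<close>. By \<open>sum1\<close>
  their exponents add up to 1, which fixes the volume, and the same exponents turn
  \<open>R i powr (s i * p i)\<close> into \<open>M powr (1 - p i / q)\<close>, the homogeneity that
  \<open>power_level_le\<close> asks for.\<close>

lemma strong_level_le:
  fixes v :: "real^'n::finite \<Rightarrow> real" and p s e :: "'n \<Rightarrow> real"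
  assumes v: "v \<in> borel_measurable borel"
    and A: "A \<in> sets borel" and B: "B \<in> sets borel"
    and vA: "\<And>x. x \<in> A \<Longrightarrow> v x = L" and vB: "\<And>x. x \<notin> B \<Longrightarrow> v x = 0"
    and L: "0 < L" and p: "\<And>i. 1 < p i" "\<And>i. p i < q"
    and s0: "0 < s0" and s: "\<And>i. s0 \<le> s i" "\<And>i. s i < 1"
    and sum1: "(\<Sum>i\<in>UNIV. (1 / p i - 1 / q) / s i) = 1"
    and a: "emeasure lborel A = ennreal a" and b: "emeasure lborel B = ennreal b" "0 < b"
    and ab: "2 powr (- (q + 1)) * b \<le> a"
    and e: "\<And>i. frac_energy (s i) (p i) i v \<le> ennreal (e i)" "\<And>i. 0 \<le> e i"
  shows "ennreal (L powr q * a) \<le> (\<Sum>i\<in>UNIV.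
    ennreal ((real CARD('n) * level_const CARD('n) q s0) powr q * e i powr (q / p i - 1))
      * frac_energy (s i) (p i) i v)"
proof -
  let ?n = "real CARD('n)"
  define K where "K = level_const CARD('n) q s0"
  \<comment> \<open>\<open>undefined\<close> stands for an arbitrary index.\<close>
  have q: "1 < q" using p[of undefined] by linarith
  have s01: "s0 < 1" using s[of undefined] by linarith
  have K: "1 \<le> K" unfolding K_def using q s0 s01 by (intro one_le_level_const) (auto simp: Suc_leI)
  have spos: "0 < s i" for i using s(1)[of i] s0 by linarith
  have apos: "0 < a" by (rule less_le_trans[OF _ ab]) (use b in simp)
  \<comment> \<open>Halving all sides divides their product by 2 to the power
    \<open>CARD('n)\<close>, so this scale yields the volume \<open>2 * b\<close>.\<close>
  define M where "M = 2 powr (?n + 1) * b"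
  have M: "0 < M" using b by (simp add: M_def)
  define R where "R i = M powr ((1 / p i - 1 / q) / s i)" for i
  have R: "0 < R i" for i using M by (simp add: R_def)
  have Rb: "(\<Prod>i\<in>UNIV. R i / 2) = 2 * b"
  proof -
    have "(\<Prod>i\<in>UNIV. R i) = M powr (\<Sum>i\<in>UNIV. (1 / p i - 1 / q) / s i)"
      unfolding R_def using M by (subst powr_sum) auto
    also have "\<dots> = M" using M by (simp add: sum1)
    finally show ?thesis by (simp add: prod_dividef M_def powr_add powr_realpow)
  qed
  define \<epsilon> where "\<epsilon> i = enn2real (frac_energy (s i) (p i) i v)" for i
  have \<epsilon>: "frac_energy (s i) (p i) i v = ennreal (\<epsilon> i)" for i
    unfolding \<epsilon>_def using e(1)[of i] by (simp add: order_le_less_trans top.not_eq_extremum)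
  have \<epsilon>0: "0 \<le> \<epsilon> i" for i by (simp add: \<epsilon>_def)
  have \<epsilon>e: "\<epsilon> i \<le> e i" for i using e[of i] by (simp add: \<epsilon>)
  have coef: "4 * (L / (2 * ?n)) powr (- p i) * R i powr (s i * p i) * (p i / s i)
      \<le> K * L powr (- p i) * a powr (1 - p i / q)" for i
  proof -
    have pq: "0 < p i" "p i < q" using p[of i] by auto
    have "(1 / p i - 1 / q) / s i * (s i * p i) = 1 - p i / q"
      using spos[of i] pq q by (simp add: field_simps)
    then have "R i powr (s i * p i) = M powr (1 - p i / q)"
      by (simp add: R_def powr_powr)
    also have "\<dots> \<le> (2 powr (?n + q + 2) * a) powr (1 - p i / q)"
    proof (intro powr_mono2)
      have "M = 2 powr (?n + q + 2) * (2 powr (- (q + 1)) * b)"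
        unfolding M_def mult.assoc[symmetric] powr_add[symmetric] by simp
      also have "\<dots> \<le> 2 powr (?n + q + 2) * a" by (intro mult_left_mono ab) auto
      finally show "M \<le> 2 powr (?n + q + 2) * a" .
    qed (use M pq in auto)
    also have "\<dots> = (2 powr (?n + q + 2)) powr (1 - p i / q) * a powr (1 - p i / q)"
      using apos by (simp add: powr_mult)
    \<comment> \<open>The exponent is at most 1 and the base at least 1, so the bound becomes
      uniform in \<open>p i\<close>.\<close>
    also have "\<dots> \<le> 2 powr (?n + q + 2) * a powr (1 - p i / q)"
    proof (intro mult_right_mono)
      have "(2 powr (?n + q + 2)) powr (1 - p i / q) \<le> (2 powr (?n + q + 2)) powr 1"
        using q pq by (intro powr_mono ge_one_powr_ge_zero) auto
      then show "(2 powr (?n + q + 2)) powr (1 - p i / q) \<le> 2 powr (?n + q + 2)" by simp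
    qed auto
    finally have 1: "R i powr (s i * p i) \<le> 2 powr (?n + q + 2) * a powr (1 - p i / q)" .
    have 2: "(L / (2 * ?n)) powr (- p i) \<le> (2 * ?n) powr q * L powr (- p i)"
    proof -
      have "(L / (2 * ?n)) powr (- p i) = (2 * ?n) powr p i * L powr (- p i)"
        using L by (simp add: powr_divide powr_minus field_simps)
      moreover have "(2 * ?n) powr p i \<le> (2 * ?n) powr q"
      proof -
        have "1 \<le> ?n" by (simp add: Suc_leI)
        then have "1 \<le> 2 * ?n" by linarith
        then show ?thesis using pq by (intro powr_mono) linarith+
      qed
      ultimately show ?thesis by (simp add: mult_right_mono)
    qed
    have 3: "p i / s i \<le> q / s0"
      using pq s(1)[of i] s0 by (intro frac_le) auto
    have "4 * (L / (2 * ?n)) powr (- p i) * R i powr (s i * p i) * (p i / s i)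
      \<le> 4 * ((2 * ?n) powr q * L powr (- p i)) * (2 powr (?n + q + 2) * a powr (1 - p i / q)) * (q / s0)"
      using 1 2 3 pq spos[of i] by (intro mult_mono) auto
    also have "\<dots> = K * L powr (- p i) * a powr (1 - p i / q)"
      by (simp add: K_def level_const_def)
    finally show ?thesis .
  qed
  have "ennreal a \<le> (\<Sum>i\<in>UNIV. ennreal (4 * (L / (2 * ?n)) powr (- p i) * R i powr (s i * p i) * (p i / s i)) * ennreal (\<epsilon> i))"
    using emeasure_level_le_energy[where p = p and s = s and R = R, OF v A B vA vB L p(1) spos s(2) R b Rb] by (simp add: a \<epsilon>)
  also have "\<dots> \<le> (\<Sum>i\<in>UNIV. ennreal (K * L powr (- p i) * a powr (1 - p i / q)) * ennreal (\<epsilon> i))"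
    by (intro sum_mono mult_right_mono ennreal_leI coef) auto
  also have "\<dots> = ennreal (\<Sum>i\<in>UNIV. K * L powr (- p i) * a powr (1 - p i / q) * \<epsilon> i)"
    using K \<epsilon>0 by (subst sum_ennreal[symmetric]) (auto intro!: sum.cong simp: ennreal_mult)
  finally have "a \<le> (\<Sum>i\<in>UNIV. K * L powr (- p i) * a powr (1 - p i / q) * \<epsilon> i)"
    using K \<epsilon>0 by (subst (asm) ennreal_le_iff) (auto intro!: sum_nonneg)
  from power_level_le[OF apos L p K \<epsilon>0 \<epsilon>e this]
  have "ennreal (L powr q * a) \<le> ennreal (\<Sum>i\<in>UNIV. (?n * K) powr q * e i powr (q / p i - 1) * \<epsilon> i)"
    by (rule ennreal_leI)
  also have "\<dots> = (\<Sum>i\<in>UNIV. ennreal ((?n * K) powr q * e i powr (q / p i - 1)) * ennreal (\<epsilon> i))"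
    using \<epsilon>0 by (subst sum_ennreal[symmetric]) (auto intro!: sum.cong simp: ennreal_mult)
  finally show ?thesis by (simp add: \<epsilon> K_def)
qed

section \<open>Dyadic slices and their energies\<close>

text \<open>Written as a difference of truncations so that sums over consecutive \<open>k\<close>
  telescope; the values range from 0 to \<open>2 powr of_int k\<close>.\<close>

definition slice :: "int \<Rightarrow> real \<Rightarrow> real" where
  "slice k t = min \<bar>t\<bar> (2 powr (of_int k + 1)) - min \<bar>t\<bar> (2 powr of_int k)"

lemma measurable_slice [measurable]: "slice k \<in> borel_measurable borel"
  by (simp add: slice_def[abs_def])

lemma slice_eq_0: "\<bar>t\<bar> \<le> 2 powr of_int k \<Longrightarrow> slice k t = 0"
  by (auto simp: slice_def powr_add)

lemma slice_eq_top: "2 powr (of_int k + 1) \<le> \<bar>t\<bar> \<Longrightarrow> slice k t = 2 powr of_int k"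
  by (auto simp: slice_def powr_add min_def)

lemma slice_mono: "\<bar>a\<bar> \<le> \<bar>b\<bar> \<Longrightarrow> slice k a \<le> slice k b"
  by (auto simp: slice_def powr_add min_def)

lemma sum_slice:
  assumes "M \<le> N"
  shows "(\<Sum>k\<in>{M..<N}. slice k t) = min \<bar>t\<bar> (2 powr of_int N) - min \<bar>t\<bar> (2 powr of_int M)"
  using assms
proof (induction N rule: int_ge_induct)
  case (step N)
  have "{M..<N + 1} = insert N {M..<N}" using step.hyps by auto
  then show ?case using step.IH by (simp add: slice_def)
qed simp

text \<open>Every slice is monotone in the absolute value, so all differences have the same sign and
  their absolute values telescope exactly.\<close>

lemma sum_slice_diff_le: "(\<Sum>k\<in>{M..<N}. \<bar>slice k a - slice k b\<bar>) \<le> \<bar>a - b\<bar>"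
proof (cases "M \<le> N")
  case True
  have *: "(\<Sum>k\<in>{M..<N}. \<bar>slice k a - slice k b\<bar>) \<le> \<bar>a - b\<bar>" if "\<bar>b\<bar> \<le> \<bar>a\<bar>" for a b
  proof -
    have "(\<Sum>k\<in>{M..<N}. \<bar>slice k a - slice k b\<bar>) = (\<Sum>k\<in>{M..<N}. slice k a - slice k b)"
      using slice_mono[OF that] by (intro sum.cong) auto
    also have "\<dots> = (min \<bar>a\<bar> (2 powr of_int N) - min \<bar>a\<bar> (2 powr of_int M)) -
        (min \<bar>b\<bar> (2 powr of_int N) - min \<bar>b\<bar> (2 powr of_int M))"
      using True by (simp add: sum_subtractf sum_slice)
    also have "\<dots> \<le> \<bar>a\<bar> - \<bar>b\<bar>"
    proof -
      have "(2::real) powr of_int M \<le> 2 powr of_int N" using True by simp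
      then show ?thesis using that by (auto simp: min_def)
    qed
    finally show ?thesis by simp
  qed
  show ?thesis
    using *[of a b] *[of b a] by (cases "\<bar>b\<bar> \<le> \<bar>a\<bar>") (auto simp: abs_minus_commute)
qed simp

text \<open>In each term all but one power is bounded by the full difference; the remaining first
  powers add up by \<open>sum_slice_diff_le\<close>.\<close>

lemma sum_slice_powr_le:
  assumes "1 \<le> p"
  shows "(\<Sum>k\<in>{M..<N}. \<bar>slice k a - slice k b\<bar> powr p) \<le> \<bar>a - b\<bar> powr p"
proof -
  have pow: "t powr p = t * t powr (p - 1)" if "0 \<le> t" for t :: real
    using that by (cases "t = 0") (auto simp: powr_diff)
  have "(\<Sum>k\<in>{M..<N}. \<bar>slice k a - slice k b\<bar> powr p)
      \<le> (\<Sum>k\<in>{M..<N}. \<bar>slice k a - slice k b\<bar> * \<bar>a - b\<bar> powr (p - 1))"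
  proof (intro sum_mono)
    fix k
    \<comment> \<open>A one-point range specialises the sum bound to a single slice.\<close>
    have "{k..<k + 1} = {k}" for k :: int by auto
    then have "\<bar>slice k a - slice k b\<bar> \<le> \<bar>a - b\<bar>"
      using sum_slice_diff_le[of a b k "k + 1"] by simp
    then show "\<bar>slice k a - slice k b\<bar> powr p \<le> \<bar>slice k a - slice k b\<bar> * \<bar>a - b\<bar> powr (p - 1)"
      using assms by (subst pow) (auto intro!: mult_left_mono powr_mono2)
  qed
  also have "\<dots> \<le> \<bar>a - b\<bar> * \<bar>a - b\<bar> powr (p - 1)"
    unfolding sum_distrib_right[symmetric] by (intro mult_right_mono sum_slice_diff_le) auto
  finally show ?thesis by (simp add: pow[of "\<bar>a - b\<bar>"])
qed

text \<open>A finite set of integers lies in an interval, so it suffices to bound sums over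
  intervals, where telescoping works.\<close>

lemma nn_integral_count_space_int_le:
  fixes f :: "int \<Rightarrow> ennreal"
  assumes "\<And>M N. (\<Sum>k\<in>{M..<N}. f k) \<le> c"
  shows "(\<integral>\<^sup>+ k. f k \<partial>count_space UNIV) \<le> c"
proof -
  let ?g = "from_nat_into (UNIV :: int set)"
  have bij: "bij ?g"
    by (rule bij_betw_from_nat_into) (auto simp: infinite_UNIV_int)
  have "(\<integral>\<^sup>+ k. f k \<partial>count_space UNIV) = (\<Sum>j. f (?g j))"
    by (subst nn_integral_bij_count_space[OF bij, symmetric]) (simp add: nn_integral_count_space_nat)
  also have "\<dots> \<le> c"
  proof (rule suminf_le_const)
    fix n
    have inj: "inj_on ?g {..<n}" using bij by (auto simp: bij_def intro: inj_on_subset)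
    have "bdd_below (?g ` {..<n})" "bdd_above (?g ` {..<n})" by auto
    then obtain a b where ab: "\<And>x. x \<in> ?g ` {..<n} \<Longrightarrow> a \<le> x" "\<And>x. x \<in> ?g ` {..<n} \<Longrightarrow> x \<le> b"
      unfolding bdd_below_def bdd_above_def by blast
    have "(\<Sum>j<n. f (?g j)) = (\<Sum>k\<in>?g ` {..<n}. f k)"
      using inj by (simp add: sum.reindex)
    also have "\<dots> \<le> (\<Sum>k\<in>{a..<b+1}. f k)"
      using ab by (intro sum_mono2) fastforce+
    also have "\<dots> \<le> c" by (rule assms)
    finally show "(\<Sum>j<n. f (?g j)) \<le> c" .
  qed simp
  finally show ?thesis .
qed

text \<open>Tonelli brings the sum over \<open>k\<close> innermost, where
  \<open>sum_slice_powr_le\<close> applies pointwise.\<close>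

lemma frac_energy_slices_le:
  fixes u :: "real^'n::finite \<Rightarrow> real"
  assumes [measurable]: "u \<in> borel_measurable borel" and p: "1 \<le> p"
  shows "(\<integral>\<^sup>+ k. frac_energy s p i (\<lambda>x. slice k (u x)) \<partial>count_space UNIV) \<le> frac_energy s p i u"
proof -
  let ?d = "\<lambda>v x h. ennreal (\<bar>v x - v (x + h *\<^sub>R axis i 1)\<bar> powr p / \<bar>h\<bar> powr (1 + s * p))"
  let ?v = "\<lambda>k x. slice k (u x)"
  have en: "frac_energy s p i v = ennreal (s * (1 - s)) * (\<integral>\<^sup>+ x. (\<integral>\<^sup>+ h. ?d v x h \<partial>lborel) \<partial>lborel)"
    if [measurable]: "v \<in> borel_measurable borel" for v :: "real^'n \<Rightarrow> real"
    unfolding frac_energy_def frac_deriv_pow_def nn_integral_completion by (rule nn_integral_cmult) measurable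
  have "(\<integral>\<^sup>+ k. frac_energy s p i (?v k) \<partial>count_space UNIV)
     = ennreal (s * (1 - s)) * (\<integral>\<^sup>+ k. (\<integral>\<^sup>+ x. (\<integral>\<^sup>+ h. ?d (?v k) x h \<partial>lborel) \<partial>lborel) \<partial>count_space UNIV)"
    by (subst en, measurable, rule nn_integral_cmult) simp
  also have "(\<integral>\<^sup>+ k. (\<integral>\<^sup>+ x. (\<integral>\<^sup>+ h. ?d (?v k) x h \<partial>lborel) \<partial>lborel) \<partial>count_space UNIV)
     = (\<integral>\<^sup>+ x. (\<integral>\<^sup>+ k. (\<integral>\<^sup>+ h. ?d (?v k) x h \<partial>lborel) \<partial>count_space UNIV) \<partial>lborel)"
    by (rule nn_integral_count_space_nn_integral[symmetric]) auto
  also have "\<dots> = (\<integral>\<^sup>+ x. (\<integral>\<^sup>+ h. (\<integral>\<^sup>+ k. ?d (?v k) x h \<partial>count_space UNIV) \<partial>lborel) \<partial>lborel)"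
    by (intro nn_integral_cong nn_integral_count_space_nn_integral[symmetric]) auto
  also have "\<dots> \<le> (\<integral>\<^sup>+ x. (\<integral>\<^sup>+ h. ?d u x h \<partial>lborel) \<partial>lborel)"
  proof (intro nn_integral_mono nn_integral_count_space_int_le)
    fix x :: "real^'n" and h :: real and M N :: int
    let ?y = "x + h *\<^sub>R axis i 1"
    have "(\<Sum>k\<in>{M..<N}. ?d (?v k) x h)
        = ennreal ((\<Sum>k\<in>{M..<N}. \<bar>?v k x - ?v k ?y\<bar> powr p) / \<bar>h\<bar> powr (1 + s * p))"
      by (simp add: sum_divide_distrib)
    also have "\<dots> \<le> ?d u x h"
      by (intro ennreal_leI divide_right_mono sum_slice_powr_le p) auto
    finally show "(\<Sum>k\<in>{M..<N}. ?d (?v k) x h) \<le> ?d u x h" .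
  qed
  finally show ?thesis by (simp add: en mult_left_mono)
qed

section \<open>Layer-cake sums over dyadic heights\<close>

text \<open>By \<open>1 \<le> q\<close> the terms form a geometric progression of ratio at least 2,
  whose sum is at most twice its largest term.\<close>

lemma dyadic_sum_le:
  assumes "1 \<le> q" "0 \<le> t"
  shows "(\<integral>\<^sup>+ k. ennreal ((2 powr of_int k) powr q) * indicator {k. 2 powr of_int k < t} k \<partial>count_space UNIV)
    \<le> ennreal (2 * t powr q)"
proof (rule nn_integral_count_space_int_le)
  fix M N :: int
  let ?f = "\<lambda>k::int. (2 powr of_int k) powr q * indicator {k. 2 powr of_int k < t} k"
  \<comment> \<open>The induction needs the sharper bound by the largest possible term:
    \<open>of_int N - 1\<close> is the last exponent in the range.\<close>
  have "(\<Sum>k\<in>{M..<N}. ?f k) \<le> 2 * (min t (2 powr (of_int N - 1))) powr q" if "M \<le> N"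
    using that
  proof (induction N rule: int_ge_induct)
    case base
    show ?case using assms by simp
  next
    case (step N)
    have ins: "{M..<N + 1} = insert N {M..<N}" using step.hyps by auto
    have eq: "(\<Sum>k\<in>{M..<N + 1}. ?f k) = ?f N + (\<Sum>k\<in>{M..<N}. ?f k)"
      unfolding ins by (rule sum.insert) auto
    let ?y = "2 powr of_int N :: real"
    have y: "0 < ?y" "2 powr (of_int N - 1) = ?y / 2" by (auto simp: powr_diff)
    show ?case
    proof (cases "?y < t")
      case True
      have "(2::real) powr 1 \<le> 2 powr q" using assms by (intro powr_mono) auto
      then have "2 * (?y / 2) powr q \<le> ?y powr q"
        using y by (simp add: powr_divide field_simps)
      then show ?thesis using step.IH True y by (simp add: eq min_def)
    next
      case False
      have "min t (?y / 2) powr q \<le> min t ?y powr q"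
        using assms by (intro powr_mono2) (auto simp: min_le_iff_disj)
      then show ?thesis using step.IH False y by (simp add: eq)
    qed
  qed
  moreover have "(min t (2 powr (of_int N - 1))) powr q \<le> t powr q"
    using assms by (intro powr_mono2) auto
  ultimately have "(\<Sum>k\<in>{M..<N}. ?f k) \<le> 2 * t powr q"
    by (cases "M \<le> N") auto
  moreover have "(\<Sum>k\<in>{M..<N}. ennreal ((2 powr of_int k) powr q) * indicator {k. 2 powr of_int k < t} k)
      = ennreal (\<Sum>k\<in>{M..<N}. ?f k)"
    by (subst sum_ennreal[symmetric]) (auto intro!: sum.cong split: split_indicator)
  ultimately show "(\<Sum>k\<in>{M..<N}. ennreal ((2 powr of_int k) powr q) * indicator {k. 2 powr of_int k < t} k)
      \<le> ennreal (2 * t powr q)"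
    by (simp add: ennreal_leI)
qed

lemma le_dyadic_sum:
  assumes "0 < q" "0 \<le> t"
  shows "ennreal (t powr q)
    \<le> ennreal (2 powr q) * (\<integral>\<^sup>+ k. ennreal ((2 powr of_int k) powr q) * indicator {k. 2 powr of_int k < t} k \<partial>count_space UNIV)"
proof (cases "t = 0")
  case False
  with assms have t: "0 < t" by simp
  \<comment> \<open>The ceiling minus one places t in the half-open interval from 2^k, excluded, to
    2^(k+1), included, even when t is a power of two. This single term suffices.\<close>
  define k where "k = \<lceil>log 2 t\<rceil> - 1"
  have k: "of_int k < log 2 t" "log 2 t \<le> of_int k + 1" unfolding k_def by linarith+
  have 1: "2 powr of_int k < t"
    using k(1) t by (simp add: less_log_iff)
  have "t \<le> 2 powr (of_int k + 1)"
    using k(2) t by (simp add: log_le_iff)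
  then have "t powr q \<le> (2 * 2 powr of_int k) powr q"
    using assms by (intro powr_mono2) (auto simp: powr_add)
  also have "\<dots> = 2 powr q * (2 powr of_int k) powr q" by (simp add: powr_mult)
  finally have "ennreal (t powr q) \<le> ennreal (2 powr q) * ennreal ((2 powr of_int k) powr q)"
    by (simp add: ennreal_leI flip: ennreal_mult)
  also have "ennreal ((2 powr of_int k) powr q) = ennreal ((2 powr of_int k) powr q) * indicator {k. 2 powr of_int k < t} k"
    using 1 by simp
  also have "\<dots> \<le> (\<integral>\<^sup>+ k. ennreal ((2 powr of_int k) powr q) * indicator {k. 2 powr of_int k < t} k \<partial>count_space UNIV)"
    by (rule nn_integral_ge_point) simp
  finally show ?thesis by (simp add: mult_left_mono)
qed (use assms in simp)

lemma nn_integral_dyadic: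
  fixes u :: "'a::euclidean_space \<Rightarrow> real" and c :: ennreal
  assumes [measurable]: "u \<in> borel_measurable borel"
  shows "(\<integral>\<^sup>+ x. c * (\<integral>\<^sup>+ k. ennreal ((2 powr of_int k) powr q) * indicator {k. 2 powr of_int k < \<bar>u x\<bar>} k \<partial>count_space UNIV) \<partial>lborel)
    = c * (\<integral>\<^sup>+ k. ennreal ((2 powr of_int k) powr q) * emeasure lborel {x. 2 powr of_int k < \<bar>u x\<bar>} \<partial>count_space (UNIV :: int set))"
proof -
  let ?w = "\<lambda>k::int. c * ennreal ((2 powr of_int k) powr q)"
  have "(\<integral>\<^sup>+ x. c * (\<integral>\<^sup>+ k. ennreal ((2 powr of_int k) powr q) * indicator {k. 2 powr of_int k < \<bar>u x\<bar>} k \<partial>count_space UNIV) \<partial>lborel)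
    = (\<integral>\<^sup>+ x. (\<integral>\<^sup>+ k. ?w k * indicator {x. 2 powr of_int k < \<bar>u x\<bar>} x \<partial>count_space UNIV) \<partial>lborel)"
    by (intro nn_integral_cong, subst nn_integral_cmult[symmetric])
       (auto intro!: nn_integral_cong simp: mult.assoc split: split_indicator)
  also have "\<dots> = (\<integral>\<^sup>+ k. (\<integral>\<^sup>+ x. ?w k * indicator {x. 2 powr of_int k < \<bar>u x\<bar>} x \<partial>lborel) \<partial>count_space UNIV)"
    by (rule nn_integral_count_space_nn_integral) auto
  also have "\<dots> = (\<integral>\<^sup>+ k. c * (ennreal ((2 powr of_int k) powr q) * emeasure lborel {x. 2 powr of_int k < \<bar>u x\<bar>}) \<partial>count_space (UNIV :: int set))"
    by (intro nn_integral_cong, subst nn_integral_cmult_indicator) (auto simp: mult.assoc)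
  also have "\<dots> = c * (\<integral>\<^sup>+ k. ennreal ((2 powr of_int k) powr q) * emeasure lborel {x. 2 powr of_int k < \<bar>u x\<bar>} \<partial>count_space (UNIV :: int set))"
    by (rule nn_integral_cmult) simp
  finally show ?thesis .
qed

section \<open>Summation over the levels and absorption\<close>

text \<open>Dichotomy at the ratio \<open>2 powr (- (q + 1))\<close>. Above it
  \<open>strong_level_le\<close> applies to the slice; below it, raising the height gains
  \<open>2 powr q\<close> in weight against a loss of at least \<open>2 powr (q + 1)\<close> in
  measure, hence the factor 1/2. As \<open>e\<close> is any bound on the slice energy, one choice
  can serve all \<open>k\<close>.\<close>

lemma dyadic_level_le:
  fixes u :: "real^'n::finite \<Rightarrow> real" and p s e :: "'n \<Rightarrow> real" and k :: int
  assumes u [measurable]: "u \<in> borel_measurable borel"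
    and p: "\<And>i. 1 < p i" "\<And>i. p i < q"
    and s0: "0 < s0" and s: "\<And>i. s0 \<le> s i" "\<And>i. s i < 1"
    and sum1: "(\<Sum>i\<in>UNIV. (1 / p i - 1 / q) / s i) = 1"
    and e: "\<And>i. frac_energy (s i) (p i) i (\<lambda>x. slice k (u x)) \<le> ennreal (e i)" "\<And>i. 0 \<le> e i"
    and fin: "emeasure lborel {x. 2 powr of_int k < \<bar>u x\<bar>} < \<infinity>"
  defines "c \<equiv> \<lambda>i. ennreal (2 powr q * ((real CARD('n) * level_const CARD('n) q s0) powr q * e i powr (q / p i - 1)))"
  shows "ennreal ((2 powr of_int (k + 1)) powr q) * emeasure lborel {x. 2 powr of_int (k + 1) < \<bar>u x\<bar>}
    \<le> (\<Sum>i\<in>UNIV. c i * frac_energy (s i) (p i) i (\<lambda>x. slice k (u x)))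
      + ennreal (1/2) * (ennreal ((2 powr of_int k) powr q) * emeasure lborel {x. 2 powr of_int k < \<bar>u x\<bar>})"
proof -
  let ?l = "2 powr of_int k :: real"
  define A where "A = {x. 2 powr of_int (k + 1) < \<bar>u x\<bar>}"
  define B where "B = {x. ?l < \<bar>u x\<bar>}"
  have meas [measurable]: "A \<in> sets borel" "B \<in> sets borel" by (auto simp: A_def B_def)
  have AB: "A \<subseteq> B" by (auto simp: A_def B_def powr_add intro: le_less_trans[rotated])
  have q: "1 < q" using p[of undefined] by linarith
  obtain b where b: "emeasure lborel B = ennreal b" "0 \<le> b"
    using fin by (cases "emeasure lborel B") (auto simp: B_def)
  obtain a where a: "emeasure lborel A = ennreal a" "0 \<le> a"
    using emeasure_mono[OF AB, of lborel] b by (cases "emeasure lborel A") (auto simp: top_unique)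
  have ab: "a \<le> b" using emeasure_mono[OF AB, of lborel] a b by simp
  have l: "(2 powr of_int (k + 1)) powr q = 2 powr q * ?l powr q"
    by (simp add: powr_add powr_mult mult.commute)
  show ?thesis
  proof (cases "0 < b \<and> 2 powr (- (q + 1)) * b \<le> a")
    case True
    have "ennreal (?l powr q * a) \<le> (\<Sum>i\<in>UNIV.
      ennreal ((real CARD('n) * level_const CARD('n) q s0) powr q * e i powr (q / p i - 1))
      * frac_energy (s i) (p i) i (\<lambda>x. slice k (u x)))"
    proof (rule strong_level_le[where A = A and B = B and b = b])
      show "slice k (u x) = ?l" if "x \<in> A" for x
        using that by (intro slice_eq_top) (simp add: A_def)
      show "slice k (u x) = 0" if "x \<notin> B" for x
        using that by (intro slice_eq_0) (simp add: B_def)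
    qed (use True a b p s0 s sum1 e in auto)
    then have "ennreal (2 powr q) * ennreal (?l powr q * a) \<le> ennreal (2 powr q) * (\<Sum>i\<in>UNIV.
      ennreal ((real CARD('n) * level_const CARD('n) q s0) powr q * e i powr (q / p i - 1))
      * frac_energy (s i) (p i) i (\<lambda>x. slice k (u x)))"
      by (rule mult_left_mono) auto
    also have "\<dots> = (\<Sum>i\<in>UNIV. c i * frac_energy (s i) (p i) i (\<lambda>x. slice k (u x)))"
      unfolding c_def by (subst sum_distrib_left) (auto simp: ennreal_mult'' mult.assoc intro!: sum.cong)
    also have "ennreal (2 powr q) * ennreal (?l powr q * a) = ennreal ((2 powr of_int (k + 1)) powr q) * emeasure lborel A"
      unfolding l a using a by (simp add: mult.assoc flip: ennreal_mult)
    finally show ?thesis unfolding A_def by (rule add_increasing2[rotated]) simp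
  next
    case False
    \<comment> \<open>The case \<open>b = 0\<close> also falls here and forces
      \<open>a = 0\<close>.\<close>
    have "2 powr q * a \<le> b / 2"
    proof (cases "b = 0")
      case False
      then have "a \<le> 2 powr (- (q + 1)) * b" using \<open>\<not> (0 < b \<and> _)\<close> b by auto
      then have "2 powr q * a \<le> 2 powr q * (2 powr (- (q + 1)) * b)" by (intro mult_left_mono) auto
      also have "\<dots> = 2 powr (- 1) * b" unfolding mult.assoc[symmetric] powr_add[symmetric] by simp
      finally show ?thesis by (simp add: powr_minus)
    qed (use ab a in simp)
    then have "?l powr q * (2 powr q * a) \<le> ?l powr q * (b / 2)" by (intro mult_left_mono) auto
    then have "ennreal (2 powr q * ?l powr q * a) \<le> ennreal (1 / 2 * (?l powr q * b))"
      by (intro ennreal_leI) (simp add: ac_simps)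
    then have "ennreal ((2 powr of_int (k + 1)) powr q) * emeasure lborel A
       \<le> ennreal (1/2) * (ennreal (?l powr q) * emeasure lborel B)"
      unfolding l a b using a(2) b(2)
      by (subst ennreal_mult[symmetric], simp, simp, subst ennreal_mult[symmetric], simp, simp,
          subst ennreal_mult[symmetric]) auto
    then show ?thesis unfolding A_def B_def by (rule add_increasing[rotated]) simp
  qed
qed

text \<open>Summing \<open>dyadic_level_le\<close> over all \<open>k\<close> bounds the dyadic sum
  \<open>X\<close> by the energies plus half of \<open>X\<close>; \<open>fin\<close> makes
  \<open>X\<close> finite, so this half can be subtracted.\<close>

lemma nn_integral_powr_le_energy:
  fixes u :: "real^'n::finite \<Rightarrow> real" and p s e :: "'n \<Rightarrow> real"
  assumes u [measurable]: "u \<in> borel_measurable borel"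
    and p: "\<And>i. 1 < p i" "\<And>i. p i < q"
    and s0: "0 < s0" and s: "\<And>i. s0 \<le> s i" "\<And>i. s i < 1"
    and sum1: "(\<Sum>i\<in>UNIV. (1 / p i - 1 / q) / s i) = 1"
    and e: "\<And>i. frac_energy (s i) (p i) i u = ennreal (e i)" "\<And>i. 0 \<le> e i"
    and fin: "(\<integral>\<^sup>+ x. ennreal (\<bar>u x\<bar> powr q) \<partial>lborel) < \<infinity>"
  shows "(\<integral>\<^sup>+ x. ennreal (\<bar>u x\<bar> powr q) \<partial>lborel)
    \<le> ennreal (2 * 4 powr q * (real CARD('n) * level_const CARD('n) q s0) powr q * (\<Sum>i\<in>UNIV. e i powr (q / p i)))"
proof -
  define D where "D = (real CARD('n) * level_const CARD('n) q s0) powr q"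
  have D: "0 \<le> D" by (simp add: D_def)
  have q: "1 < q" using p[of undefined] by linarith
  define F where "F k = ennreal ((2 powr of_int k) powr q) * emeasure lborel {x. 2 powr of_int k < \<bar>u x\<bar>}" for k :: int
  define X where "X = (\<integral>\<^sup>+ k. F k \<partial>count_space UNIV)"
  have X: "X = (\<integral>\<^sup>+ x. (\<integral>\<^sup>+ k. ennreal ((2 powr of_int k) powr q) * indicator {k. 2 powr of_int k < \<bar>u x\<bar>} k \<partial>count_space UNIV) \<partial>lborel)"
    unfolding X_def F_def using nn_integral_dyadic[OF u, of 1 q] by simp
  have "X \<le> (\<integral>\<^sup>+ x. ennreal 2 * ennreal (\<bar>u x\<bar> powr q) \<partial>lborel)"
    unfolding X using q by (intro nn_integral_mono order_trans[OF dyadic_sum_le]) (auto simp: ennreal_mult)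
  also have "\<dots> = ennreal 2 * (\<integral>\<^sup>+ x. ennreal (\<bar>u x\<bar> powr q) \<partial>lborel)"
    by (rule nn_integral_cmult) measurable
  also have "\<dots> < \<infinity>" using fin by (simp add: ennreal_mult_less_top)
  finally have Xfin: "X < \<infinity>" .
  define c where "c i = ennreal (2 powr q * (D * e i powr (q / p i - 1)))" for i
  define G where "G k = (\<Sum>i\<in>UNIV. c i * frac_energy (s i) (p i) i (\<lambda>x. slice k (u x)))" for k
  have step: "F (k + 1) \<le> G k + ennreal (1/2) * F k" for k
    unfolding F_def G_def c_def D_def
  proof (rule dyadic_level_le[OF u p s0 s sum1 _ e(2)])
    \<comment> \<open>A single term of a finite sum is finite, and its weight is positive, so each
      level set has finite measure.\<close>
    have "F k \<le> X" unfolding X_def by (rule nn_integral_ge_point) simp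
    then have "F k < \<infinity>" using Xfin by (rule le_less_trans)
    then show "emeasure lborel {x. 2 powr of_int k < \<bar>u x\<bar>} < \<infinity>"
      by (auto simp: F_def ennreal_mult_less_top)
    fix i
    have "frac_energy (s i) (p i) i (\<lambda>x. slice k (u x))
        \<le> (\<integral>\<^sup>+ k. frac_energy (s i) (p i) i (\<lambda>x. slice k (u x)) \<partial>count_space UNIV)"
      by (rule nn_integral_ge_point) simp
    also have "\<dots> \<le> frac_energy (s i) (p i) i u"
      using p(1)[of i] by (intro frac_energy_slices_le u) simp
    finally show "frac_energy (s i) (p i) i (\<lambda>x. slice k (u x)) \<le> ennreal (e i)" by (simp add: e)
  qed
  have Gle: "(\<integral>\<^sup>+ k. G k \<partial>count_space UNIV) \<le> ennreal (2 powr q * D * (\<Sum>i\<in>UNIV. e i powr (q / p i)))"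
  proof -
    have "(\<integral>\<^sup>+ k. G k \<partial>count_space UNIV)
       = (\<Sum>i\<in>UNIV. c i * (\<integral>\<^sup>+ k. frac_energy (s i) (p i) i (\<lambda>x. slice k (u x)) \<partial>count_space UNIV))"
      unfolding G_def by (subst nn_integral_sum) (auto simp: nn_integral_cmult)
    also have "\<dots> \<le> (\<Sum>i\<in>UNIV. c i * ennreal (e i))"
      unfolding e(1)[symmetric] using p(1)
      by (intro sum_mono mult_left_mono frac_energy_slices_le u) (auto intro: less_imp_le)
    also have "\<dots> = (\<Sum>i\<in>UNIV. ennreal (2 powr q * D * e i powr (q / p i)))"
    proof (intro sum.cong refl)
      fix i
      \<comment> \<open>The power carried by the full energy and the summed slice energies recombine
        to \<open>e i powr (q / p i)\<close>.\<close>
      have "e i powr (q / p i - 1) * e i = e i powr (q / p i)"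
        using e(2)[of i] by (cases "e i = 0") (auto simp: powr_diff)
      then show "c i * ennreal (e i) = ennreal (2 powr q * D * e i powr (q / p i))"
        using e(2)[of i] D by (simp add: c_def mult.assoc flip: ennreal_mult)
    qed
    also have "\<dots> = ennreal (2 powr q * D * (\<Sum>i\<in>UNIV. e i powr (q / p i)))"
      using D by (subst sum_ennreal) (auto simp: sum_distrib_left)
    finally show ?thesis .
  qed
  define g where "g = 2 powr q * D * (\<Sum>i\<in>UNIV. e i powr (q / p i))"
  have g0: "0 \<le> g" using D by (auto simp: g_def intro!: mult_nonneg_nonneg sum_nonneg)
  \<comment> \<open>The shift of index leaves a sum over all integers unchanged, which puts the same
    \<open>X\<close> on both sides.\<close>
  have "bij (\<lambda>k::int. k + 1)" by (rule bijI') (auto intro: exI[of _ "_ - 1"] simp: algebra_simps)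
  then have "X = (\<integral>\<^sup>+ k. F (k + 1) \<partial>count_space UNIV)"
    unfolding X_def by (rule nn_integral_bij_count_space[symmetric])
  also have "\<dots> \<le> (\<integral>\<^sup>+ k. G k + ennreal (1/2) * F k \<partial>count_space UNIV)"
    by (intro nn_integral_mono step)
  also have "\<dots> = (\<integral>\<^sup>+ k. G k \<partial>count_space UNIV) + ennreal (1/2) * X"
    unfolding X_def by (subst nn_integral_add) (auto simp: nn_integral_cmult)
  also have "\<dots> \<le> ennreal g + ennreal (1/2) * X"
    using Gle by (intro add_mono) (auto simp: g_def)
  finally have absorb: "X \<le> ennreal g + ennreal (1/2) * X" .
  obtain r where r: "X = ennreal r" "0 \<le> r"
    using Xfin by (cases X) auto
  have "ennreal (1/2) * ennreal r = ennreal (r / 2)"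
    using r by (subst ennreal_mult[symmetric]) auto
  then have "ennreal r \<le> ennreal (g + r / 2)"
    using absorb r g0 by (subst ennreal_plus) auto
  then have "r \<le> g + r / 2"
    using g0 r(2) by (subst (asm) ennreal_le_iff) auto
  then have Xle: "X \<le> ennreal (2 * g)"
    unfolding r(1) by (intro ennreal_leI) simp
  have "(\<integral>\<^sup>+ x. ennreal (\<bar>u x\<bar> powr q) \<partial>lborel) \<le> (\<integral>\<^sup>+ x. ennreal (2 powr q) *
     (\<integral>\<^sup>+ k. ennreal ((2 powr of_int k) powr q) * indicator {k. 2 powr of_int k < \<bar>u x\<bar>} k \<partial>count_space UNIV) \<partial>lborel)"
    using q by (intro nn_integral_mono le_dyadic_sum) auto
  also have "\<dots> = ennreal (2 powr q) * X"
    unfolding X_def F_def by (rule nn_integral_dyadic[OF u])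
  also have "\<dots> \<le> ennreal (2 powr q) * ennreal (2 * g)" by (intro mult_left_mono Xle) auto
  \<comment> \<open>One \<open>2 powr q\<close> comes from comparing with dyadic heights, the other
    from \<open>g\<close>; the 2 comes from the absorption.\<close>
  also have "\<dots> = ennreal (2 * (2 powr q * 2 powr q) * D * (\<Sum>i\<in>UNIV. e i powr (q / p i)))"
    using g0 by (simp add: g_def ac_simps flip: ennreal_mult)
  also have "2 powr q * 2 powr q = (4::real) powr q"
    by (simp flip: powr_mult)
  finally show ?thesis by (simp add: D_def)
qed

section \<open>Passage to Borel representatives\<close>

text \<open>A given line may lie inside the exceptional set. By Tonelli and translation invariance
  this set still meets the line through almost every \<open>x\<close> in a one-dimensional null
  set.\<close>

lemma AE_lborel_shift_line:
  fixes P :: "'a::euclidean_space \<Rightarrow> bool" and e :: 'a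
  assumes "AE x in lborel. P x"
  shows "AE x in lborel. AE h in lborel. P (x + h *\<^sub>R e)"
proof -
  from assms obtain N where N: "{x \<in> space lborel. \<not> P x} \<subseteq> N" "emeasure lborel N = 0" "N \<in> sets lborel"
    by (rule AE_E)
  have [measurable]: "N \<in> sets borel" using N(3) by simp
  have "(\<integral>\<^sup>+ x. (\<integral>\<^sup>+ h. indicator N (x + h *\<^sub>R e) \<partial>lborel) \<partial>lborel)
      = (\<integral>\<^sup>+ h. (\<integral>\<^sup>+ x. indicator N (x + h *\<^sub>R e) \<partial>lborel) \<partial>(lborel :: real measure))"
    by (rule lborel_pair.Fubini') measurable
  also have "\<dots> = (\<integral>\<^sup>+ h. (\<integral>\<^sup>+ x. indicator N x \<partial>lborel) \<partial>(lborel :: real measure))"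
    by (intro nn_integral_cong nn_integral_lborel_shift) measurable
  also have "\<dots> = 0" using N by simp
  finally have "AE x in lborel. (\<integral>\<^sup>+ h. indicator N (x + h *\<^sub>R e) \<partial>(lborel :: real measure)) = 0"
    by (subst (asm) nn_integral_0_iff_AE) auto
  then show ?thesis
  proof eventually_elim
    case (elim x)
    then have "AE h in lborel. indicator N (x + h *\<^sub>R e) = (0 :: ennreal)"
      by (subst (asm) nn_integral_0_iff_AE) auto
    then show ?case
      by eventually_elim (use N(1) in \<open>auto simp: indicator_def split: if_splits\<close>)
  qed
qed

text \<open>For almost every \<open>x\<close> the functions agree at \<open>x\<close> and at almost
  every point of the line through it, so the inner integrals coincide. This is what permits a Borel
  representative.\<close>

lemma frac_energy_cong_AE:
  fixes u v :: "real^'n::finite \<Rightarrow> real"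
  assumes "AE x in lborel. u x = v x"
  shows "frac_energy s p i u = frac_energy s p i v"
proof -
  have "AE x in lborel. frac_deriv_pow s p i u x = frac_deriv_pow s p i v x"
    using assms AE_lborel_shift_line[OF assms, of "axis i 1"]
  proof eventually_elim
    case (elim x)
    show ?case
      unfolding frac_deriv_pow_def nn_integral_completion
      by (intro arg_cong2[where f = "(*)"] refl nn_integral_cong_AE)
         (use elim(2) in \<open>eventually_elim, simp add: elim(1)\<close>)
  qed
  then show ?thesis
    unfolding frac_energy_def nn_integral_completion by (rule nn_integral_cong_AE)
qed

section \<open>The exponent relation and the final inequality\<close>

text \<open>In terms of \<open>S\<close> and \<open>T\<close> the exponent \<open>pstar s p\<close>
  is \<open>S / (T - 1)\<close>, while the sum is \<open>T - 1 / pstar s p * S\<close>. The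
  condition \<open>lt\<close> says that \<open>1 < T\<close>.\<close>

lemma pstar_relation:
  fixes s p :: "'n::finite \<Rightarrow> real"
  assumes s: "\<And>i. 0 < s i" and p: "\<And>i. 0 < p i" and lt: "spbar s p < real CARD('n)"
  shows "(\<Sum>i\<in>UNIV. (1 / p i - 1 / pstar s p) / s i) = 1"
proof -
  define S where "S = (\<Sum>i\<in>UNIV. 1 / s i)"
  define T where "T = (\<Sum>i\<in>UNIV. 1 / (s i * p i))"
  let ?n = "real CARD('n)"
  have n: "0 < ?n" by simp
  have S: "0 < S" unfolding S_def using s by (intro sum_pos) auto
  have T: "0 < T" unfolding T_def using s p by (intro sum_pos) auto
  have bars: "sbar s = ?n / S" "spbar s p = ?n / T"
    by (auto simp: sbar_def spbar_def S_def T_def)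
  have T1: "1 < T" using lt n T by (simp add: bars field_simps)
  have "pstar s p = S / (T - 1)"
  proof -
    have "?n - ?n / T = ?n * (T - 1) / T" using T by (simp add: field_simps)
    then show ?thesis using n S T T1 by (simp add: pstar_def bars)
  qed
  then have "1 / pstar s p * S = T - 1" using S by simp
  moreover have "(\<Sum>i\<in>UNIV. (1 / p i - 1 / pstar s p) / s i) = T - 1 / pstar s p * S"
    by (simp add: S_def T_def diff_divide_distrib sum_subtractf sum_distrib_left mult.commute)
  ultimately show ?thesis by simp
qed

text \<open>The \<open>q\<close>-th root of the constant in
  \<open>nn_integral_powr_le_energy\<close>, where the extra \<open>real n\<close> counts the
  directions.\<close>

definition sobolev_const :: "nat \<Rightarrow> real \<Rightarrow> real \<Rightarrow> real" where
  "sobolev_const n q s0 = (2 * 4 powr q * (real n * level_const n q s0) powr q * real n) powr (1 / q)"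

lemma Lnorm_le_aniso_norm:
  fixes u :: "real^'n::finite \<Rightarrow> real" and p s :: "'n \<Rightarrow> real"
  assumes p: "\<And>i. 1 < p i" "\<And>i. p i < pstar s p"
    and s0: "0 < s0" and s: "\<And>i. s0 \<le> s i" "\<And>i. s i < 1"
    and lt: "spbar s p < real CARD('n)" and u: "u \<in> aniso_space s p"
  shows "Lnorm (pstar s p) u \<le> sobolev_const CARD('n) (pstar s p) s0 * aniso_norm s p u"
proof -
  define q where "q = pstar s p"
  have pq: "p i < q" for i using p(2) by (simp add: q_def)
  have q: "1 < q" using p(1) pq by (rule less_trans)
  have sum1: "(\<Sum>i\<in>UNIV. (1 / p i - 1 / q) / s i) = 1"
    unfolding q_def using s0 s p by (intro pstar_relation lt) (auto intro: less_le_trans less_trans[OF zero_less_one])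
  from u have uL: "u \<in> borel_measurable lebesgue" "integrable lebesgue (\<lambda>x. \<bar>u x\<bar> powr q)"
    and ufin: "(\<Sum>i\<in>UNIV. frac_energy (s i) (p i) i u) < \<infinity>"
    by (auto simp: aniso_space_def Lspace_def q_def)
  obtain v where v: "v \<in> borel_measurable lborel" and uv: "AE x in lborel. u x = v x"
    using completion_ex_borel_measurable_real[OF uL(1)] by auto
  have vb: "v \<in> borel_measurable borel" using v by simp
  define e where "e i = enn2real (frac_energy (s i) (p i) i u)" for i
  have e0: "0 \<le> e i" for i by (simp add: e_def)
  \<comment> \<open>The sum of the energies is finite, hence so is each of them, and
    \<open>enn2real\<close> loses nothing.\<close>
  have e: "frac_energy (s i) (p i) i v = ennreal (e i)" for i
    unfolding e_def frac_energy_cong_AE[OF uv, symmetric] using ufin by simp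
  have "(\<integral>\<^sup>+ x. ennreal (\<bar>v x\<bar> powr q) \<partial>lborel) = (\<integral>\<^sup>+ x. ennreal (\<bar>u x\<bar> powr q) \<partial>lborel)"
    by (rule nn_integral_cong_AE) (use uv in \<open>eventually_elim, simp\<close>)
  also have "\<dots> = ennreal (LINT x|lebesgue. \<bar>u x\<bar> powr q)"
    using nn_integral_eq_integral[OF uL(2)] by (simp add: nn_integral_completion)
  finally have I: "(\<integral>\<^sup>+ x. ennreal (\<bar>v x\<bar> powr q) \<partial>lborel) = ennreal (LINT x|lebesgue. \<bar>u x\<bar> powr q)" .
  define K where "K = 2 * 4 powr q * (real CARD('n) * level_const CARD('n) q s0) powr q"
  have K: "0 \<le> K" by (simp add: K_def)
  define N where "N = aniso_norm s p u"
  have N: "N = (\<Sum>i\<in>UNIV. e i powr (1 / p i))" by (simp add: N_def aniso_norm_def e_def)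
  have N0: "0 \<le> N" unfolding N by (intro sum_nonneg) auto
  have "(LINT x|lebesgue. \<bar>u x\<bar> powr q) \<le> K * (\<Sum>i\<in>UNIV. e i powr (q / p i))"
  proof -
    have "ennreal (LINT x|lebesgue. \<bar>u x\<bar> powr q) \<le> ennreal (K * (\<Sum>i\<in>UNIV. e i powr (q / p i)))"
      unfolding I[symmetric] K_def
      by (rule nn_integral_powr_le_energy[OF vb p(1) pq s0 s sum1 e e0]) (simp add: I)
    then show ?thesis
      using K by (subst (asm) ennreal_le_iff) (auto intro!: mult_nonneg_nonneg sum_nonneg)
  qed
  \<comment> \<open>Each summand of the norm is at most \<open>N\<close>, so the different powers of
    the energies all reduce to \<open>N powr q\<close>.\<close>
  also have "\<dots> \<le> K * (\<Sum>i\<in>(UNIV::'n set). N powr q)"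
  proof (intro mult_left_mono sum_mono K)
    fix i
    have "e i powr (q / p i) = (e i powr (1 / p i)) powr q" by (simp add: powr_powr)
    also have "\<dots> \<le> N powr q"
      using q unfolding N by (intro powr_mono2 member_le_sum) auto
    finally show "e i powr (q / p i) \<le> N powr q" .
  qed
  also have "\<dots> = K * real CARD('n) * N powr q" by simp
  finally have "Lnorm q u \<le> (K * real CARD('n) * N powr q) powr (1 / q)"
    unfolding Lnorm_def using q by (intro powr_mono2) (auto intro!: integral_nonneg_AE)
  also have "\<dots> = (K * real CARD('n)) powr (1 / q) * N"
    using q K N0 by (simp add: powr_mult powr_powr)
  finally show ?thesis by (simp add: sobolev_const_def K_def N_def q_def)
qed

theorem theorem1p1:
  "\<exists>C :: nat \<Rightarrow> real \<Rightarrow> real \<Rightarrow> real \<Rightarrow> real.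
     \<forall>(s0 :: real) (s :: 'n::finite \<Rightarrow> real) (p :: 'n \<Rightarrow> real).
       0 < s0 \<and> s0 < 1 \<and> (\<forall>i. s0 \<le> s i \<and> s i < 1) \<and> (\<forall>i. 1 < p i) \<and>
       spbar s p < real CARD('n) \<and> pmax p < pstar s p \<longrightarrow>
         0 < C CARD('n) (pstar s p) (pstar s p - pmax p) s0 \<and>
         (\<forall>u \<in> aniso_space s p.
            Lnorm (pstar s p) u
              \<le> C CARD('n) (pstar s p) (pstar s p - pmax p) s0 * aniso_norm s p u)"
proof (intro exI[of _ "\<lambda>n q _ s0. sobolev_const n q s0"] allI impI)
  fix s0 :: real and s p :: "'n \<Rightarrow> real"
  assume *: "0 < s0 \<and> s0 < 1 \<and> (\<forall>i. s0 \<le> s i \<and> s i < 1) \<and> (\<forall>i. 1 < p i) \<and>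
    spbar s p < real CARD('n) \<and> pmax p < pstar s p"
  \<comment> \<open>The gap between \<open>pmax p\<close> and \<open>pstar s p\<close> enters as one
    strict inequality per direction.\<close>
  have pq: "p i < pstar s p" for i
    using * Max_ge[of "range p" "p i"] by (auto simp: pmax_def)
  have q: "1 < pstar s p" using * pq less_trans by blast
  have "1 \<le> level_const CARD('n) (pstar s p) s0"
    using * q by (intro one_le_level_const) (auto simp: Suc_leI)
  then have "0 < sobolev_const CARD('n) (pstar s p) s0"
    by (simp add: sobolev_const_def)
  moreover have "Lnorm (pstar s p) u \<le> sobolev_const CARD('n) (pstar s p) s0 * aniso_norm s p u"
    if "u \<in> aniso_space s p" for u
    using * pq that by (intro Lnorm_le_aniso_norm) auto
  ultimately show "0 < sobolev_const CARD('n) (pstar s p) s0 \<and>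
      (\<forall>u\<in>aniso_space s p. Lnorm (pstar s p) u \<le> sobolev_const CARD('n) (pstar s p) s0 * aniso_norm s p u)"
    by blast
qed

end
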